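(* Let $f$ and $g$ be positive regular free holomorphic functions with $n$ and $q$ indeterminates, respectively, and let $m,l,p\ge1$, with $\mathbf D_f^m(\mathcal H)$ and $\mathbf D_g^l(\mathcal H)$ norm-closed and starlike, $\mathcal H$ a separable infinite dimensional Hilbert space. If $F:\mathbf D_f^m(\mathcal H)\to\mathbf D_g^l(\mathcal H)$ is a free biholomorphic function, then $n=q$ and its representation on $\mathbb C^p$, i.e., the map $F_p$ defined by $$\mathbb C^{np^2}\supset\mathbf D_f^m(\mathbb C^p)\ni(\Lambda_1,\dots,\Lambda_n)\mapsto F(\Lambda_1,\dots,\Lambda_n)\in\mathbf D_g^l(\mathbb C^p)\subset\mathbb C^{qp^2},$$ is a homeomorphism from $\mathbf D_f^m(\mathbb C^p)$ onto $\mathbf D_g^l(\mathbb C^p)$ and a biholomorphic function from $\mathrm{Int}(\mathbf D_f^m(\mathbb C^p))$ onto $\mathrm{Int}(\mathbf D_g^l(\mathbb C^p))$.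
   Context: $\mathbb F_n^+$ is the free monoid on generators $g_1,\dots,g_n$ with identity $g_0$; $|\alpha|$ is the length of $\alpha$. For $X\in B(\mathcal H)^n$ and $\alpha=g_{i_1}\cdots g_{i_k}$, $X_\alpha:=X_{i_1}\cdots X_{i_k}$, $X_{g_0}:=I$. A positive regular free holomorphic function in $n$ indeterminates is a formal power series $f=\sum_{|\alpha|\ge1}a_\alpha X_\alpha$ with $a_\alpha\ge0$, $a_{g_i}>0$ for $i=1,\dots,n$, and $\limsup_{k\to\infty}(\sum_{|\alpha|=k}|a_\alpha|^2)^{1/2k}<\infty$. For $m\ge1$ and a Hilbert space $\mathcal H$, $$\mathbf D_f^m(\mathcal H):=\{X\in B(\mathcal H)^n:\ (id-\Phi_{f,X})^k(I)\ge0,\ 1\le k\le m\},\qquad \Phi_{f,X}(Y):=\sum_{k=1}^\infty\sum_{|\alpha|=k}a_\alpha X_\alpha YX_\alpha^*$$ (weak operator convergence). Standing assumption: $\mathbf D_f^m(\mathcal H)$ and $\mathbf D_g^l(\mathcal H)$ ($\mathcal H$ separable infinite dimensional) are closed in the operator norm and starlike (stable under multiplication by $r\in[0,1)$). $\mathbf D_{f,\mathrm{rad}}^m(\mathcal H):=\bigcup_{0\le r<1}r\,\mathbf D_f^m(\mathcal H)$. A free holomorphic function on $\mathbf D_{f,\mathrm{rad}}^m$ is (the map induced by) a formal power series $\sum_\alpha c_\alpha Z_\alpha$, $c_\alpha\in\mathbb C$, such that for every Hilbert space $\mathcal K$ and $X\in\mathbf D_{f,\mathrm{rad}}^m(\mathcal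 K)$ the series $\sum_{k=0}^\infty\sum_{|\alpha|=k}c_\alpha X_\alpha$ converges in operator norm; tuples are free holomorphic if their components are. A map $F:\mathbf D_f^m(\mathcal H)\to\mathbf D_g^l(\mathcal H)$ is free biholomorphic if it is a homeomorphism in the operator norm topology and $F|_{\mathbf D_{f,\mathrm{rad}}^m(\mathcal H)}$ and $F^{-1}|_{\mathbf D_{g,\mathrm{rad}}^l(\mathcal H)}$ are free holomorphic functions. On $\mathbb C^p$, $F(\Lambda)$ is given by the same power series as $F$: if $F_j=\sum_\alpha c_\alpha^{(j)}Z_\alpha$ then the $j$-th component of $F(\Lambda)$ is $\lim_{r\to1}\sum_k\sum_{|\alpha|=k}c_\alpha^{(j)}r^{|\alpha|}\Lambda_\alpha$ for $\Lambda\in\mathbf D_f^m(\mathbb C^p)$. Here $\mathbf D_f^m(\mathbb C^p)$ is a set of $n$-tuples of $p\times p$ matrices, viewed in $\mathbb C^{np^2}$, and $\mathrm{Int}$ is the interior there. *)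

theory Defs
  imports "HOL-Analysis.Analysis"
begin

section \<open>Complex Hilbert spaces\<close>

class complex_hilbert = banach +
  fixes scaleC :: "complex \<Rightarrow> 'a \<Rightarrow> 'a" (infixr "*\<^sub>C" 75)
    and cinner :: "'a \<Rightarrow> 'a \<Rightarrow> complex"
  assumes scaleC_add_right: "c *\<^sub>C (x + y) = c *\<^sub>C x + c *\<^sub>C y"
    and scaleC_add_left: "(c + d) *\<^sub>C x = c *\<^sub>C x + d *\<^sub>C x"
    and scaleC_scaleC: "c *\<^sub>C d *\<^sub>C x = (c * d) *\<^sub>C x"
    and scaleR_scaleC: "r *\<^sub>R x = complex_of_real r *\<^sub>C x"
    and cinner_add_left: "cinner (x + y) z = cinner x z + cinner y z"
    and cinner_scaleC_left: "cinner (c *\<^sub>C x) y = c * cinner x y"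
    and cinner_commute: "cinner x y = cnj (cinner y x)"
    and cinner_self: "cinner x x = complex_of_real ((norm x)\<^sup>2)"

instantiation complex :: complex_hilbert
begin

definition scaleC_complex :: "complex \<Rightarrow> complex \<Rightarrow> complex" where
  "scaleC_complex c x = c * x"

definition cinner_complex :: "complex \<Rightarrow> complex \<Rightarrow> complex" where
  "cinner_complex x y = x * cnj y"

instance
proof
  fix x :: complex
  show "cinner x x = complex_of_real ((norm x)\<^sup>2)"
    unfolding cinner_complex_def by (rule complex_norm_square[symmetric])
qed (simp_all add: scaleC_complex_def cinner_complex_def distrib_left distrib_right mult.assoc
    mult.commute scaleR_conv_of_real)

end

instantiation vec :: (complex_hilbert, finite) complex_hilbert
begin

definition scaleC_vec :: "complex \<Rightarrow> 'a ^ 'b \<Rightarrow> 'a ^ 'b" where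
  "scaleC_vec c x = (\<chi> i. c *\<^sub>C (x $ i))"

definition cinner_vec :: "'a ^ 'b \<Rightarrow> 'a ^ 'b \<Rightarrow> complex" where
  "cinner_vec x y = (\<Sum>i\<in>UNIV. cinner (x $ i) (y $ i))"

instance
proof
  fix x y :: "'a ^ 'b"
  show "cinner x y = cnj (cinner y x)"
    unfolding cinner_vec_def cnj_sum by (rule sum.cong[OF refl]) (rule cinner_commute)
  show "cinner x x = complex_of_real ((norm x)\<^sup>2)"
    by (simp add: cinner_vec_def cinner_self norm_vec_def L2_set_def sum_nonneg)
qed (simp_all add: scaleC_vec_def cinner_vec_def vec_eq_iff scaleC_add_right scaleC_add_left
    scaleC_scaleC scaleR_scaleC cinner_add_left cinner_scaleC_left sum.distrib sum_distrib_left)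

end

definition infinite_dimensional :: "'h::complex_hilbert itself \<Rightarrow> bool" where
  "infinite_dimensional _ \<longleftrightarrow>
     (\<forall>B :: 'h set. finite B \<longrightarrow> (\<exists>x. \<forall>u. x \<noteq> (\<Sum>b\<in>B. u b *\<^sub>C b)))"

section \<open>Bounded operators\<close>

text \<open>The type of \<^term>\<open>T :: 'h \<Rightarrow>\<^sub>L 'h\<close> consists of the bounded real-linear maps; the
  complex-linear ones form a closed subset, on which its norm is the usual operator norm.\<close>

definition clinear_op :: "('h::complex_hilbert \<Rightarrow>\<^sub>L 'h) \<Rightarrow> bool" where
  "clinear_op T \<longleftrightarrow> (\<forall>c x. blinfun_apply T (c *\<^sub>C x) = c *\<^sub>C blinfun_apply T x)"

lemma norm_scaleC: "norm (c *\<^sub>C x) = cmod c * norm (x :: 'a::complex_hilbert)"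
proof -
  have "complex_of_real ((norm (c *\<^sub>C x))\<^sup>2) = c * cinner x (c *\<^sub>C x)"
    by (simp only: cinner_self[symmetric] cinner_scaleC_left)
  also have "cinner x (c *\<^sub>C x) = cnj c * cinner x x"
    by (subst cinner_commute) (simp add: cinner_scaleC_left cinner_commute[of x x, symmetric])
  also have "c * (cnj c * cinner x x) = complex_of_real ((cmod c * norm x)\<^sup>2)"
    by (simp add: cinner_self power_mult_distrib complex_norm_square[symmetric])
  finally have "(norm (c *\<^sub>C x))\<^sup>2 = (cmod c * norm x)\<^sup>2"
    by (simp only: of_real_eq_iff)
  then show ?thesis
    by (simp add: power2_eq_iff_nonneg)
qed

lemma bounded_linear_scaleC: "bounded_linear (\<lambda>x :: 'a::complex_hilbert. c *\<^sub>C x)"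
  by (rule bounded_linear_intro[where K = "cmod c"])
    (auto simp: scaleC_add_right scaleR_scaleC scaleC_scaleC norm_scaleC mult.commute)

definition scaleC_op :: "complex \<Rightarrow> ('h::complex_hilbert \<Rightarrow>\<^sub>L 'h) \<Rightarrow> ('h \<Rightarrow>\<^sub>L 'h)" where
  "scaleC_op c T = Blinfun (\<lambda>x. c *\<^sub>C blinfun_apply T x)"

lemma scaleC_op_apply: "blinfun_apply (scaleC_op c T) x = c *\<^sub>C blinfun_apply T x"
  unfolding scaleC_op_def
  by (subst bounded_linear_Blinfun_apply)
    (auto intro: bounded_linear_compose[OF bounded_linear_scaleC] blinfun.bounded_linear_right)

definition adj_op :: "('h::complex_hilbert \<Rightarrow>\<^sub>L 'h) \<Rightarrow> ('h \<Rightarrow>\<^sub>L 'h)" where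
  "adj_op T = (THE S. \<forall>x y. cinner (blinfun_apply T x) y = cinner x (blinfun_apply S y))"

definition positive_op :: "('h::complex_hilbert \<Rightarrow>\<^sub>L 'h) \<Rightarrow> bool" where
  "positive_op T \<longleftrightarrow>
     (\<forall>x. Im (cinner (blinfun_apply T x) x) = 0 \<and> 0 \<le> Re (cinner (blinfun_apply T x) x))"

text \<open>A quantifier over Hilbert spaces cannot range over types inside a formula. A Hilbert space
  is therefore presented as a closed subspace of the ambient Hilbert space \<^typ>\<open>'h\<close>, namely as
  the range of an orthogonal projection \<open>P\<close>. Its bounded operators are the elements of the corner
  \<open>P B('h) P\<close>, and its identity operator is \<open>P\<close>. The choice \<^term>\<open>P = id_blinfun\<close> gives the Hilbert
  space \<^typ>\<open>'h\<close> itself.\<close>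

definition orth_projection :: "('h::complex_hilbert \<Rightarrow>\<^sub>L 'h) \<Rightarrow> bool" where
  "orth_projection P \<longleftrightarrow> clinear_op P \<and> P o\<^sub>L P = P \<and>
     (\<forall>x y. cinner (blinfun_apply P x) y = cinner x (blinfun_apply P y))"

definition bounded_ops :: "('h::complex_hilbert \<Rightarrow>\<^sub>L 'h) \<Rightarrow> ('h \<Rightarrow>\<^sub>L 'h) set" where
  "bounded_ops P = {T. clinear_op T \<and> P o\<^sub>L T = T \<and> T o\<^sub>L P = T}"

section \<open>Noncommutative domains\<close>

text \<open>The free monoid on the generators indexed by \<open>'n\<close> is \<open>'n list\<close>; a formal power series is
  its coefficient function.\<close>

definition op_word ::
  "('h::complex_hilbert \<Rightarrow>\<^sub>L 'h) \<Rightarrow> ('h \<Rightarrow>\<^sub>L 'h) ^ 'n \<Rightarrow> 'n list \<Rightarrow> ('h \<Rightarrow>\<^sub>L 'h)" where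
  "op_word P X \<alpha> = foldr (\<lambda>i T. (X $ i) o\<^sub>L T) \<alpha> P"

definition positive_regular :: "('n::finite list \<Rightarrow> real) \<Rightarrow> bool" where
  "positive_regular a \<longleftrightarrow> a [] = 0 \<and> (\<forall>\<alpha>. 0 \<le> a \<alpha>) \<and> (\<forall>i. 0 < a [i]) \<and>
     limsup (\<lambda>k. ereal (root (2 * k) (\<Sum>\<alpha> | length \<alpha> = k. \<bar>a \<alpha>\<bar>\<^sup>2))) < \<infinity>"

text \<open>\<open>Z\<close> is the sum of the series for \<open>\<Phi>\<^sub>f\<^sub>,\<^sub>X(Y)\<close> in the weak operator topology.\<close>

definition is_Phi ::
  "('n::finite list \<Rightarrow> real) \<Rightarrow> ('h::complex_hilbert \<Rightarrow>\<^sub>L 'h) \<Rightarrow> ('h \<Rightarrow>\<^sub>L 'h) ^ 'n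
     \<Rightarrow> ('h \<Rightarrow>\<^sub>L 'h) \<Rightarrow> ('h \<Rightarrow>\<^sub>L 'h) \<Rightarrow> bool" where
  "is_Phi a P X Y Z \<longleftrightarrow>
     (\<forall>x y. (\<lambda>k. cinner (blinfun_apply (\<Sum>\<alpha> | length \<alpha> = Suc k.
                a \<alpha> *\<^sub>R (op_word P X \<alpha> o\<^sub>L Y o\<^sub>L adj_op (op_word P X \<alpha>))) x) y)
             sums cinner (blinfun_apply Z x) y)"

definition Phi ::
  "('n::finite list \<Rightarrow> real) \<Rightarrow> ('h::complex_hilbert \<Rightarrow>\<^sub>L 'h) \<Rightarrow> ('h \<Rightarrow>\<^sub>L 'h) ^ 'n
     \<Rightarrow> ('h \<Rightarrow>\<^sub>L 'h) \<Rightarrow> ('h \<Rightarrow>\<^sub>L 'h)" where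
  "Phi a P X Y = (THE Z. is_Phi a P X Y Z)"

text \<open>Membership includes that \<open>\<Phi>\<^sub>f\<^sub>,\<^sub>X\<close> is defined, i.e. that its series converges on every bounded
  operator; otherwise the positivity conditions would be meaningless.\<close>

definition nc_domain ::
  "('n::finite list \<Rightarrow> real) \<Rightarrow> nat \<Rightarrow> ('h::complex_hilbert \<Rightarrow>\<^sub>L 'h) \<Rightarrow> (('h \<Rightarrow>\<^sub>L 'h) ^ 'n) set" where
  "nc_domain a m P = {X. (\<forall>i. X $ i \<in> bounded_ops P) \<and>
     (\<forall>Y\<in>bounded_ops P. \<exists>Z. is_Phi a P X Y Z) \<and>
     (\<forall>k\<in>{1..m}. positive_op (((\<lambda>Y. Y - Phi a P X Y) ^^ k) P))}"

definition nc_domain_rad ::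
  "('n::finite list \<Rightarrow> real) \<Rightarrow> nat \<Rightarrow> ('h::complex_hilbert \<Rightarrow>\<^sub>L 'h) \<Rightarrow> (('h \<Rightarrow>\<^sub>L 'h) ^ 'n) set" where
  "nc_domain_rad a m P = (\<Union>r\<in>{0..<1::real}. (\<lambda>X. r *\<^sub>R X) ` nc_domain a m P)"

definition starlike_at_0 :: "'a::real_vector set \<Rightarrow> bool" where
  "starlike_at_0 S \<longleftrightarrow> (\<forall>X\<in>S. \<forall>r\<in>{0..<1::real}. r *\<^sub>R X \<in> S)"

section \<open>Free holomorphic functions\<close>

definition homogeneous_part ::
  "('n::finite list \<Rightarrow> complex) \<Rightarrow> ('h::complex_hilbert \<Rightarrow>\<^sub>L 'h) \<Rightarrow> ('h \<Rightarrow>\<^sub>L 'h) ^ 'n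
     \<Rightarrow> nat \<Rightarrow> ('h \<Rightarrow>\<^sub>L 'h)" where
  "homogeneous_part c P X k = (\<Sum>\<alpha> | length \<alpha> = k. scaleC_op (c \<alpha>) (op_word P X \<alpha>))"

text \<open>The Hilbert spaces over which the defining convergence condition ranges are all closed
  subspaces of the (arbitrary) ambient Hilbert space \<open>'k\<close>.\<close>

definition free_holomorphic ::
  "'k::complex_hilbert itself \<Rightarrow> ('n::finite list \<Rightarrow> real) \<Rightarrow> nat \<Rightarrow> ('n list \<Rightarrow> complex) \<Rightarrow> bool" where
  "free_holomorphic _ a m c \<longleftrightarrow>
     (\<forall>P :: 'k \<Rightarrow>\<^sub>L 'k. orth_projection P \<longrightarrow>
        (\<forall>X\<in>nc_domain_rad a m P. summable (homogeneous_part c P X)))"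

text \<open>\<open>F\<close> is, on the radial part of the domain over the Hilbert space \<open>'h\<close>, the map induced by the
  tuple \<open>c\<close> of free holomorphic functions.\<close>

definition free_holomorphic_rep ::
  "'k::complex_hilbert itself \<Rightarrow> ('n::finite list \<Rightarrow> real) \<Rightarrow> nat \<Rightarrow> ('q::finite \<Rightarrow> 'n list \<Rightarrow> complex)
     \<Rightarrow> (('h::complex_hilbert \<Rightarrow>\<^sub>L 'h) ^ 'n \<Rightarrow> ('h \<Rightarrow>\<^sub>L 'h) ^ 'q) \<Rightarrow> bool" where
  "free_holomorphic_rep K a m c F \<longleftrightarrow>
     (\<forall>j. free_holomorphic K a m (c j)) \<and>
     (\<forall>X\<in>nc_domain_rad a m id_blinfun. \<forall>j. homogeneous_part (c j) id_blinfun X sums (F X $ j))"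

definition free_biholomorphic ::
  "'k::complex_hilbert itself \<Rightarrow> ('n::finite list \<Rightarrow> real) \<Rightarrow> nat \<Rightarrow> ('q::finite list \<Rightarrow> real) \<Rightarrow> nat
     \<Rightarrow> (('h::complex_hilbert \<Rightarrow>\<^sub>L 'h) ^ 'n \<Rightarrow> ('h \<Rightarrow>\<^sub>L 'h) ^ 'q) \<Rightarrow> bool" where
  "free_biholomorphic K a m b l F \<longleftrightarrow>
     (\<exists>G. homeomorphism (nc_domain a m id_blinfun) (nc_domain b l id_blinfun) F G \<and>
          (\<exists>c. free_holomorphic_rep K a m c F) \<and>
          (\<exists>d. free_holomorphic_rep K b l d G))"

section \<open>Representations on matrices\<close>

definition matrix_op :: "complex ^ 'p ^ 'p \<Rightarrow> ((complex ^ 'p::finite) \<Rightarrow>\<^sub>L (complex ^ 'p))" where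
  "matrix_op A = Blinfun (\<lambda>x. A *v x)"

lemma matrix_op_apply: "blinfun_apply (matrix_op A) x = A *v x"
proof -
  have "linear (\<lambda>x. A *v x)"
    by (rule linearI)
      (simp_all add: matrix_vector_right_distrib matrix_vector_mult_def vec_eq_iff scaleR_sum_right
        distrib_left sum.distrib)
  then show ?thesis
    unfolding matrix_op_def
    by (simp add: bounded_linear_Blinfun_apply linear_conv_bounded_linear)
qed

definition matrix_domain ::
  "('n::finite list \<Rightarrow> real) \<Rightarrow> nat \<Rightarrow> (complex ^ 'p ^ 'p ^ 'n) set" where
  "matrix_domain a m = {\<Lambda>. (\<chi> i. matrix_op (\<Lambda> $ i)) \<in> nc_domain a m id_blinfun}"

definition matrix_word :: "complex ^ 'p ^ 'p ^ 'n \<Rightarrow> 'n list \<Rightarrow> complex ^ 'p ^ 'p" where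
  "matrix_word \<Lambda> \<alpha> = foldr (\<lambda>i M. (\<Lambda> $ i) ** M) \<alpha> (mat 1)"

definition matrix_part ::
  "('n::finite list \<Rightarrow> complex) \<Rightarrow> complex ^ 'p ^ 'p ^ 'n \<Rightarrow> real \<Rightarrow> nat \<Rightarrow> complex ^ 'p ^ 'p" where
  "matrix_part c \<Lambda> r k =
     (\<Sum>\<alpha> | length \<alpha> = k. (c \<alpha> * complex_of_real (r ^ length \<alpha>)) *\<^sub>C matrix_word \<Lambda> \<alpha>)"

definition matrix_map ::
  "('q::finite \<Rightarrow> 'n::finite list \<Rightarrow> complex) \<Rightarrow> complex ^ 'p ^ 'p ^ 'n \<Rightarrow> complex ^ 'p ^ 'p ^ 'q" where
  "matrix_map c \<Lambda> = (\<chi> j. Lim (at_left 1) (\<lambda>r. \<Sum>k. matrix_part (c j) \<Lambda> r k))"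

definition matrix_map_defined ::
  "('q::finite \<Rightarrow> 'n::finite list \<Rightarrow> complex) \<Rightarrow> (complex ^ 'p ^ 'p ^ 'n) set \<Rightarrow> bool" where
  "matrix_map_defined c S \<longleftrightarrow>
     (\<forall>\<Lambda>\<in>S. \<forall>j. (\<forall>r\<in>{0..<1}. summable (matrix_part (c j) \<Lambda> r)) \<and>
        (\<exists>L. ((\<lambda>r. \<Sum>k. matrix_part (c j) \<Lambda> r k) \<longlongrightarrow> L) (at_left 1)))"

text \<open>Holomorphy in several variables on an open set: the Frechet derivative exists everywhere and
  is complex-linear.\<close>

definition sv_holomorphic_on ::
  "('a::complex_hilbert \<Rightarrow> 'b::complex_hilbert) \<Rightarrow> 'a set \<Rightarrow> bool" where
  "sv_holomorphic_on F S \<longleftrightarrow>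
     (\<forall>x\<in>S. \<exists>D. (F has_derivative D) (at x) \<and> (\<forall>c v. D (c *\<^sub>C v) = c *\<^sub>C D v))"

definition biholomorphic_onto ::
  "('a::complex_hilbert \<Rightarrow> 'b::complex_hilbert) \<Rightarrow> 'a set \<Rightarrow> 'b set \<Rightarrow> bool" where
  "biholomorphic_onto F S T \<longleftrightarrow>
     bij_betw F S T \<and> sv_holomorphic_on F S \<and> sv_holomorphic_on (inv_into S F) T"

end

theory Submission
  imports Defs "HOL-Complex_Analysis.Cauchy_Integral_Formula"
begin

text \<open>Fix an isometry \<open>V\<close> of \<open>\<complex>\<^sup>p\<close> into the Hilbert space. A matrix tuple \<open>\<Lambda>\<close> lies in the matrix
  domain iff \<open>V \<Lambda> V\<^sup>*\<close> lies in the operator domain, and letting \<open>r \<rightarrow> 1\<close> in the power series shows that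
  \<open>F\<close> sends \<open>V \<Lambda> V\<^sup>*\<close> to \<open>F\<^sub>p(\<Lambda>)\<close> on the range of \<open>V\<close> plus the scalar \<open>c\<^sub>0\<close> on its complement. Compressing
  \<open>G \<circ> F = id\<close> to the range of \<open>V\<close> gives \<open>G\<^sub>p \<circ> F\<^sub>p = id\<close>, although \<open>c\<^sub>0\<close> need not vanish. Both matrix
  domains contain a neighbourhood of \<open>0\<close>, so invariance of domain yields equality of the dimensions and
  matches the interiors. For holomorphy, the matrix domain is circular, so the homogeneous parts obey
  Cauchy estimates and \<open>F\<^sub>p\<close> is a locally uniform limit of polynomial maps.\<close>

section \<open>Adjoints and the maps \<open>\<Phi>\<close>\<close>

text \<open>Two obstacles shape the proof. First, \<open>adj_op\<close> is a definite description,
  which says something only once an adjoint has been exhibited. Adjoints are therefore carried as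
  explicit pairs, and every tuple that gets compressed must bring its own: matrices have conjugate
  transposes, inflations inherit them, and the image of an inflated tuple obtains one from its block
  form. Second, because of the constant term the image of an inflated tuple is in general not
  inflated, so \<open>G\<close> cannot be treated by repeating the argument used for
  \<open>F\<close>. What both tuples share is the relation \<open>V' T = S V'\<close>, which says
  that the adjoint of \<open>T\<close> leaves the range of \<open>V\<close> invariant. This relation
  is multiplicative, unlike compression of arbitrary operators, so words, power series and \<Phi>
  all compress along it. It is the common hypothesis under which the series of \<open>F\<close> and
  of \<open>G\<close> are evaluated on matrices.\<close>

lemma cinner_add_right: "cinner x (y + z) = cinner x y + cinner x (z :: 'a::complex_hilbert)"
  by (metis cinner_commute cinner_add_left complex_cnj_add)

lemma cinner_scaleC_right: "cinner x (c *\<^sub>C y) = cnj c * cinner x (y :: 'a::complex_hilbert)"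
  by (metis cinner_commute cinner_scaleC_left complex_cnj_mult)

text \<open>Cauchy-Schwarz, from positivity of the inner product at the part of \<open>x\<close>
  orthogonal to \<open>y\<close>.\<close>

lemma cmod_cinner_le: "cmod (cinner x y) \<le> norm x * norm (y :: 'a::complex_hilbert)"
proof (cases "y = 0")
  case True
  have "cinner x (0::'a) + cinner x (0::'a) = cinner x (0::'a)"
    by (metis add.right_neutral cinner_add_right)
  then show ?thesis
    using True by simp
next
  case False
  define c where "c = cinner x y"
  define s where "s = complex_of_real ((norm y)\<^sup>2)"
  \<comment> \<open>This is the component of \<open>x\<close> orthogonal to \<open>y\<close>,
    multiplied by the squared norm of \<open>y\<close> to avoid a division.\<close>
  define w where "w = s *\<^sub>C x + (- c) *\<^sub>C y"
  have yy: "cinner y y = s" and yx: "cinner y x = cnj c" and xy: "cinner x y = c"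
    by (simp_all add: c_def s_def cinner_self cinner_commute[of y x])
  have cs: "cnj s = s"
    by (simp add: s_def)
  have cc: "c * cnj c = complex_of_real ((cmod c)\<^sup>2)"
    by (rule complex_norm_square[symmetric])
  have "cinner w w = s * (s * cinner x x) - (c * cnj c) * s"
    unfolding w_def cinner_add_left cinner_add_right cinner_scaleC_left cinner_scaleC_right yy yx xy cs
    by (simp add: algebra_simps)
  also have "\<dots> = complex_of_real ((norm y)\<^sup>2 * ((norm x * norm y)\<^sup>2 - (cmod c)\<^sup>2))"
    unfolding cc cinner_self s_def of_real_mult[symmetric] of_real_diff[symmetric]
    by (simp only: of_real_eq_iff power_mult_distrib) (simp add: algebra_simps)
  finally have "0 \<le> (norm y)\<^sup>2 * ((norm x * norm y)\<^sup>2 - (cmod c)\<^sup>2)"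
    unfolding cinner_self by (metis of_real_eq_iff zero_le_power2)
  then have "(cmod c)\<^sup>2 \<le> (norm x * norm y)\<^sup>2"
    using False by (simp add: zero_le_mult_iff)
  then show ?thesis
    unfolding c_def by (rule power2_le_imp_le) simp
qed

interpretation cinner: bounded_bilinear "cinner :: 'a::complex_hilbert \<Rightarrow> 'a \<Rightarrow> complex"
proof
  show "\<exists>K. \<forall>a b::'a. norm (cinner a b) \<le> norm a * norm b * K"
    using cmod_cinner_le by (metis mult.right_neutral)
qed (simp_all add: cinner_add_left cinner_add_right scaleR_scaleC cinner_scaleC_left
    cinner_scaleC_right scaleC_complex_def scaleR_conv_of_real)

lemma cinner_ext_left: "(\<And>y. cinner x y = cinner x' y) \<Longrightarrow> x = (x' :: 'a::complex_hilbert)"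
proof -
  assume "\<And>y. cinner x y = cinner x' y"
  then have "cinner (x - x') (x - x') = 0"
    by (simp add: cinner.diff_left)
  then show ?thesis
    by (simp add: cinner_self)
qed

lemma cinner_ext_right: "(\<And>y. cinner y x = cinner y x') \<Longrightarrow> x = (x' :: 'a::complex_hilbert)"
  by (metis cinner_commute cinner_ext_left)

lemma scaleC_one [simp]: "1 *\<^sub>C (x :: 'a::complex_hilbert) = x"
  by (metis of_real_1 scaleR_one scaleR_scaleC)

lemma scaleC_zero_left [simp]: "0 *\<^sub>C (x :: 'a::complex_hilbert) = 0"
  using scaleR_scaleC[of 0 x] by simp

lemma scaleC_zero_right [simp]: "c *\<^sub>C (0 :: 'a::complex_hilbert) = 0"
  by (rule linear_0[OF bounded_linear.linear[OF bounded_linear_scaleC]])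

section \<open>Adjoints as explicit pairs\<close>

definition adjoint_pair ::
  "('a::complex_hilbert \<Rightarrow>\<^sub>L 'b::complex_hilbert) \<Rightarrow> ('b \<Rightarrow>\<^sub>L 'a) \<Rightarrow> bool" where
  "adjoint_pair T S \<longleftrightarrow> (\<forall>x y. cinner (T x) y = cinner x (S y))"

definition adjointable :: "('a::complex_hilbert \<Rightarrow>\<^sub>L 'b::complex_hilbert) \<Rightarrow> bool" where
  "adjointable T \<longleftrightarrow> (\<exists>S. adjoint_pair T S)"

lemma adjoint_pairD: "adjoint_pair T S \<Longrightarrow> cinner (T x) y = cinner x (S y)"
  by (simp add: adjoint_pair_def)

lemma adjoint_pair_unique:
  assumes "adjoint_pair T S" "adjoint_pair T S'"
  shows "S = S'"
  by (rule blinfun_eqI, rule cinner_ext_right)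
    (simp only: adjoint_pairD[OF assms(1), symmetric] adjoint_pairD[OF assms(2), symmetric])

lemma adjoint_pair_sym:
  assumes "adjoint_pair T S"
  shows "adjoint_pair S T"
  unfolding adjoint_pair_def
proof (intro allI)
  fix x y
  have "cinner (S x) y = cnj (cinner y (S x))"
    by (rule cinner_commute)
  also have "\<dots> = cnj (cinner (T y) x)"
    by (simp only: adjoint_pairD[OF assms])
  also have "\<dots> = cinner x (T y)"
    by (rule cinner_commute[symmetric])
  finally show "cinner (S x) y = cinner x (T y)" .
qed

lemma adjoint_pair_compose:
  "adjoint_pair T S \<Longrightarrow> adjoint_pair T' S' \<Longrightarrow> adjoint_pair (T o\<^sub>L T') (S' o\<^sub>L S)"
  by (simp add: adjoint_pair_def)

lemma adjoint_pair_id: "adjoint_pair id_blinfun id_blinfun"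
  by (simp add: adjoint_pair_def)

lemma adjoint_pair_add:
  "adjoint_pair T S \<Longrightarrow> adjoint_pair T' S' \<Longrightarrow> adjoint_pair (T + T') (S + S')"
  by (simp add: adjoint_pair_def blinfun.add_left cinner.add_left cinner.add_right)

lemma adjoint_pair_diff:
  "adjoint_pair T S \<Longrightarrow> adjoint_pair T' S' \<Longrightarrow> adjoint_pair (T - T') (S - S')"
  by (simp add: adjoint_pair_def blinfun.diff_left cinner.diff_left cinner.diff_right)

lemma adjoint_pair_scaleC_op: "adjoint_pair T S \<Longrightarrow> adjoint_pair (scaleC_op c T) (scaleC_op (cnj c) S)"
  by (simp add: adjoint_pair_def scaleC_op_apply cinner_scaleC_left cinner_scaleC_right)

text \<open>The inner product is complex-linear in its first slot, so moving \<open>T\<close> across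
  and back passes the scalar through. An exhibited adjoint thus yields complex linearity for free,
  although the type only guarantees real linearity.\<close>

lemma adjoint_pair_scaleC:
  assumes "adjoint_pair T S"
  shows "T (c *\<^sub>C x) = c *\<^sub>C T x"
  by (rule cinner_ext_left) (simp add: adjoint_pairD[OF assms] cinner_scaleC_left)

lemma adjoint_pair_clinear: "adjoint_pair T S \<Longrightarrow> clinear_op T"
  unfolding clinear_op_def by (intro allI adjoint_pair_scaleC)

text \<open>The squared norm of \<open>S y\<close> is the inner product of \<open>T (S y)\<close>
  with \<open>y\<close>; Cauchy-Schwarz and division by the norm of \<open>S y\<close> give the
  bound.\<close>

lemma adjoint_pair_norm_le:
  assumes "adjoint_pair T S"
  shows "norm S \<le> norm T"
proof (rule norm_blinfun_bound)
  fix y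
  show "norm (S y) \<le> norm T * norm y"
  proof (cases "S y = 0")
    case False
    have "(norm (S y))\<^sup>2 = cmod (cinner (S y) (S y))"
      unfolding cinner_self norm_of_real by simp
    also have "\<dots> = cmod (cinner (T (S y)) y)"
      by (simp add: adjoint_pairD[OF assms])
    also have "\<dots> \<le> norm (T (S y)) * norm y"
      by (rule cmod_cinner_le)
    also have "\<dots> \<le> norm T * norm (S y) * norm y"
      by (intro mult_right_mono norm_blinfun) auto
    finally have "norm (S y) * norm (S y) \<le> (norm T * norm y) * norm (S y)"
      by (simp add: power2_eq_square ac_simps)
    then show ?thesis
      using False by (simp add: mult_le_cancel_right)
  qed simp
qed simp

lemma adj_op_eq:
  assumes "adjoint_pair T S"
  shows "adj_op T = S"
  unfolding adj_op_def adjoint_pair_def[symmetric]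
  using assms by (rule the_equality) (rule adjoint_pair_unique[OF _ assms])

lemma adjointable_adj_op: "adjointable T \<Longrightarrow> adjoint_pair T (adj_op T)"
  unfolding adjointable_def using adj_op_eq by blast

lemma op_word_Nil [simp]: "op_word P X [] = P"
  and op_word_Cons [simp]: "op_word P X (i # \<alpha>) = X $ i o\<^sub>L op_word P X \<alpha>"
  by (simp_all add: op_word_def)

lemma adjointable_op_word:
  assumes "\<And>i. adjointable (X $ i)"
  shows "adjointable (op_word id_blinfun X \<alpha>)"
proof (induction \<alpha>)
  case Nil
  then show ?case
    by (auto simp: adjointable_def intro: adjoint_pair_id)
next
  case (Cons i \<alpha>)
  then show ?case
    using assms[of i] by (auto simp: adjointable_def dest: adjoint_pair_compose)
qed

lemma bounded_ops_id: "bounded_ops id_blinfun = {T. clinear_op T}"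
proof -
  have "id_blinfun o\<^sub>L T = T" "T o\<^sub>L id_blinfun = T" for T :: "'a \<Rightarrow>\<^sub>L 'a"
    by (auto intro: blinfun_eqI)
  then show ?thesis
    by (simp add: bounded_ops_def)
qed

section \<open>Weak sums defining \<Phi> and the defect operators\<close>

lemma is_Phi_unique: "is_Phi a P X Y Z \<Longrightarrow> is_Phi a P X Y Z' \<Longrightarrow> Z = Z'"
  unfolding is_Phi_def by (rule blinfun_eqI, rule cinner_ext_left, rule sums_unique2) auto

lemma Phi_eq:
  assumes "is_Phi a P X Y Z"
  shows "Phi a P X Y = Z"
  unfolding Phi_def using assms by (rule the_equality) (rule is_Phi_unique[OF _ assms])

text \<open>The index is shifted as in \<open>is_Phi\<close>: block \<open>k\<close> has degree
  \<open>Suc k\<close>, so the empty word never occurs.\<close>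

definition Phi_part ::
  "('n::finite list \<Rightarrow> real) \<Rightarrow> ('h::complex_hilbert \<Rightarrow>\<^sub>L 'h) ^ 'n \<Rightarrow> ('h \<Rightarrow>\<^sub>L 'h) \<Rightarrow> nat \<Rightarrow> ('h \<Rightarrow>\<^sub>L 'h)"
  where "Phi_part a X Y k = (\<Sum>\<alpha> | length \<alpha> = Suc k.
    a \<alpha> *\<^sub>R (op_word id_blinfun X \<alpha> o\<^sub>L Y o\<^sub>L adj_op (op_word id_blinfun X \<alpha>)))"

lemma is_Phi_id:
  "is_Phi a id_blinfun X Y Z \<longleftrightarrow> (\<forall>x y. (\<lambda>k. cinner (Phi_part a X Y k x) y) sums cinner (Z x) y)"
  by (simp add: is_Phi_def Phi_part_def)

lemma cinner_Phi_part:
  "cinner (Phi_part a X Y k x) y = (\<Sum>\<alpha> | length \<alpha> = Suc k. complex_of_real (a \<alpha>) *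
     cinner (op_word id_blinfun X \<alpha> (Y (adj_op (op_word id_blinfun X \<alpha>) x))) y)"
  by (simp add: Phi_part_def blinfun.sum_left cinner.sum_left blinfun.scaleR_left cinner.scaleR_left
      scaleR_conv_of_real)

text \<open>Every partial sum is complex-linear and the weak limit inherits this. It is needed for
  iterating, because membership in the domain provides \<Phi> only on complex-linear
  operators.\<close>

lemma is_Phi_clinear:
  assumes "is_Phi a id_blinfun X Y Z" "\<And>i. adjointable (X $ i)" "clinear_op Y"
  shows "clinear_op Z"
proof -
  note adj = adjointable_adj_op[OF adjointable_op_word[of X, OF assms(2)]]
  have part: "cinner (Phi_part a X Y k (c *\<^sub>C x)) y = c * cinner (Phi_part a X Y k x) y" for k c x y
    using assms(3) unfolding cinner_Phi_part
    by (simp add: clinear_op_def adjoint_pair_scaleC[OF adj]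
        adjoint_pair_scaleC[OF adjoint_pair_sym[OF adj]] cinner_scaleC_left sum_distrib_left mult.left_commute)
  have "cinner (Z (c *\<^sub>C x)) y = cinner (c *\<^sub>C Z x) y" for c x y
  proof (rule sums_unique2)
    show "(\<lambda>k. cinner (Phi_part a X Y k (c *\<^sub>C x)) y) sums cinner (Z (c *\<^sub>C x)) y"
      using assms(1) by (simp add: is_Phi_id)
    show "(\<lambda>k. cinner (Phi_part a X Y k (c *\<^sub>C x)) y) sums cinner (c *\<^sub>C Z x) y"
      unfolding part cinner_scaleC_left using assms(1) by (intro sums_mult) (simp add: is_Phi_id)
  qed
  then show ?thesis
    unfolding clinear_op_def by (intro allI) (rule cinner_ext_left)
qed

abbreviation defect ::
  "('n::finite list \<Rightarrow> real) \<Rightarrow> ('h::complex_hilbert \<Rightarrow>\<^sub>L 'h) ^ 'n \<Rightarrow> nat \<Rightarrow> ('h \<Rightarrow>\<^sub>L 'h)" where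
  "defect a X k \<equiv> ((\<lambda>Y. Y - Phi a id_blinfun X Y) ^^ k) id_blinfun"

lemma nc_domain_id:
  "X \<in> nc_domain a m id_blinfun \<longleftrightarrow> (\<forall>i. clinear_op (X $ i)) \<and>
     (\<forall>Y. clinear_op Y \<longrightarrow> (\<exists>Z. is_Phi a id_blinfun X Y Z)) \<and> (\<forall>k\<in>{1..m}. positive_op (defect a X k))"
  by (auto simp: nc_domain_def bounded_ops_id)

lemma clinear_op_diff: "clinear_op S \<Longrightarrow> clinear_op T \<Longrightarrow> clinear_op (S - T)"
  unfolding clinear_op_def
proof (intro allI)
  fix c x
  assume "\<forall>c x. S (c *\<^sub>C x) = c *\<^sub>C S x" "\<forall>c x. T (c *\<^sub>C x) = c *\<^sub>C T x"
  then show "(S - T) (c *\<^sub>C x) = c *\<^sub>C (S - T) x"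
    by (simp add: blinfun.diff_left linear_diff[OF bounded_linear.linear[OF bounded_linear_scaleC]])
qed

lemma clinear_op_id: "clinear_op id_blinfun"
  by (simp add: clinear_op_def)

lemma defect_clinear:
  assumes "\<And>Y. clinear_op Y \<Longrightarrow> \<exists>Z. is_Phi a id_blinfun X Y Z" "\<And>i. adjointable (X $ i)"
  shows "clinear_op (defect a X k)"
proof (induction k)
  case (Suc k)
  then obtain Z where Z: "is_Phi a id_blinfun X (defect a X k) Z"
    using assms(1) by blast
  then show ?case
    using Suc is_Phi_clinear[OF Z assms(2) Suc] by (simp add: Phi_eq clinear_op_diff)
qed (simp add: clinear_op_id)

section \<open>Compression and inflation along an isometry\<close>

locale isometry =
  fixes V :: "'e::complex_hilbert \<Rightarrow>\<^sub>L 'h::complex_hilbert" and V' :: "'h \<Rightarrow>\<^sub>L 'e"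
  assumes adjoint_V: "adjoint_pair V V'" and left_inverse [simp]: "V' (V x) = x"
begin

lemma cinner_V: "cinner (V x) y = cinner x (V' y)"
  by (rule adjoint_pairD[OF adjoint_V])

lemma cinner_V': "cinner (V' x) y = cinner x (V y)"
  by (rule adjoint_pairD[OF adjoint_pair_sym[OF adjoint_V]])

lemma V_scaleC: "V (c *\<^sub>C x) = c *\<^sub>C V x"
  by (rule adjoint_pair_scaleC[OF adjoint_V])

lemma V'_scaleC: "V' (c *\<^sub>C x) = c *\<^sub>C V' x"
  by (rule adjoint_pair_scaleC[OF adjoint_pair_sym[OF adjoint_V]])

lemma norm_V'_le: "norm (V' x) \<le> norm x"
proof -
  have "(norm (V' x))\<^sup>2 = cmod (cinner (V' x) (V' x))"
    unfolding cinner_self norm_of_real by simp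
  also have "\<dots> = cmod (cinner x (V (V' x)))"
    by (simp add: cinner_V')
  also have "\<dots> \<le> norm x * norm (V (V' x))"
    by (rule cmod_cinner_le)
  also have "norm (V (V' x)) = norm (V' x)"
  proof -
    have "cinner (V (V' x)) (V (V' x)) = cinner (V' x) (V' x)"
      by (simp add: cinner_V)
    then show ?thesis
      by (simp only: cinner_self of_real_eq_iff power2_eq_iff_nonneg norm_ge_zero)
  qed
  finally show ?thesis
    by (cases "V' x = 0") (simp_all add: power2_eq_square)
qed

text \<open>Equivalently, the adjoint of \<open>T\<close> leaves the range of \<open>V\<close>
  invariant and \<open>S\<close> is the compression of \<open>T\<close>. The relation survives
  products, and it holds for inflated tuples as well as for their images under
  \<open>F\<close>.\<close>

definition coinvariant :: "('h \<Rightarrow>\<^sub>L 'h) \<Rightarrow> ('e \<Rightarrow>\<^sub>L 'e) \<Rightarrow> bool" where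
  "coinvariant T S \<longleftrightarrow> (\<forall>x. V' (T x) = S (V' x))"

lemma adjointable_coinvariant:
  assumes "coinvariant T S" "adjointable T"
  shows "adjointable S"
proof -
  obtain T' where T': "adjoint_pair T T'"
    using assms(2) by (auto simp: adjointable_def)
  have "cinner (S x) y = cinner x (V' (T' (V y)))" for x y
  proof -
    have "S x = V' (T (V x))"
      using assms(1) by (simp add: coinvariant_def)
    then show ?thesis
      by (simp add: cinner_V cinner_V' adjoint_pairD[OF T'])
  qed
  then have "adjoint_pair S (V' o\<^sub>L T' o\<^sub>L V)"
    by (simp add: adjoint_pair_def)
  then show ?thesis
    by (auto simp: adjointable_def)
qed

lemma coinvariant_op_word:
  assumes "\<And>i. coinvariant (W $ i) (M $ i)"
  shows "coinvariant (op_word id_blinfun W \<alpha>) (op_word id_blinfun M \<alpha>)"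
proof (induction \<alpha>)
  case (Cons i \<alpha>)
  then show ?case
    using assms[of i] by (simp add: coinvariant_def)
qed (simp add: coinvariant_def)

text \<open>Coinvariance read on the adjoint side: it moves the adjoint words in \<Phi> through
  \<open>V\<close>, while \<open>coinvariant\<close> itself moves the words through
  \<open>V'\<close>.\<close>

lemma adj_op_coinvariant:
  assumes "coinvariant T S" "adjointable T"
  shows "adj_op T (V y) = V (adj_op S y)"
proof (rule cinner_ext_right)
  fix x
  note T = adjoint_pairD[OF adjointable_adj_op[OF assms(2)]]
  note S = adjoint_pairD[OF adjointable_adj_op[OF adjointable_coinvariant[OF assms]]]
  have "cinner x (adj_op T (V y)) = cinner (V' (T x)) y"
    by (simp only: T[symmetric] cinner_V')
  also have "\<dots> = cinner x (V (adj_op S y))"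
    using assms(1) by (simp add: coinvariant_def S cinner_V')
  finally show "cinner x (adj_op T (V y)) = cinner x (V (adj_op S y))" .
qed

text \<open>Term by term, the matrix coefficient at \<open>x\<close>, \<open>y\<close> over the
  small space equals the one at \<open>V x\<close>, \<open>V y\<close> over the large space, so weak
  convergence transfers with its limit.\<close>

lemma is_Phi_compress:
  assumes "\<And>i. coinvariant (W $ i) (M $ i)" "\<And>i. adjointable (W $ i)"
    and "is_Phi a id_blinfun W Y Z"
  shows "is_Phi a id_blinfun M (V' o\<^sub>L Y o\<^sub>L V) (V' o\<^sub>L Z o\<^sub>L V)"
proof -
  note coinv = coinvariant_op_word[of W M, OF assms(1)]
  have "cinner (Phi_part a M (V' o\<^sub>L Y o\<^sub>L V) k x) y = cinner (Phi_part a W Y k (V x)) (V y)" for k x y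
    unfolding cinner_Phi_part
    by (simp add: adj_op_coinvariant[OF coinv adjointable_op_word[OF assms(2)]]
        cinner_V'[symmetric] coinv[unfolded coinvariant_def, rule_format])
  then show ?thesis
    using assms(3) by (simp add: is_Phi_id cinner_V')
qed

text \<open>Compression commutes with \<Phi>, hence with every iterate of the defect, and
  compressing a positive operator keeps it positive.\<close>

lemma nc_domain_compress:
  assumes "\<And>i. coinvariant (W $ i) (M $ i)" "\<And>i. adjointable (W $ i)"
    and W: "W \<in> nc_domain a m id_blinfun"
  shows "M \<in> nc_domain a m id_blinfun"
  unfolding nc_domain_id
proof (intro conjI allI impI ballI)
  have exW: "\<exists>Z. is_Phi a id_blinfun W Y Z" if "clinear_op Y" for Y
    using W that by (simp add: nc_domain_id)
  have pc: "is_Phi a id_blinfun M (V' o\<^sub>L Y o\<^sub>L V) (V' o\<^sub>L Phi a id_blinfun W Y o\<^sub>L V)"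
    if "clinear_op Y" for Y
    using exW[OF that] is_Phi_compress[of W M, OF assms(1,2)] by (auto simp: Phi_eq)
  show "clinear_op (M $ i)" for i
    using adjointable_adj_op[OF adjointable_coinvariant[OF assms(1,2)]] by (rule adjoint_pair_clinear)
  fix Y :: "'e \<Rightarrow>\<^sub>L 'e"
  assume "clinear_op Y"
  \<comment> \<open>Every \<open>Y\<close> on the small space is the compression of
    \<open>V Y V'\<close>, so convergence over the large space covers all of them.\<close>
  then have "clinear_op (V o\<^sub>L Y o\<^sub>L V')"
    by (simp add: clinear_op_def V_scaleC V'_scaleC)
  from pc[OF this] have "is_Phi a id_blinfun M Y (V' o\<^sub>L Phi a id_blinfun W (V o\<^sub>L Y o\<^sub>L V') o\<^sub>L V)"
    by (simp add: is_Phi_id cinner_Phi_part)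
  then show "\<exists>Z. is_Phi a id_blinfun M Y Z" ..
next
  fix k
  assume k: "k \<in> {1..m}"
  have exW: "\<exists>Z. is_Phi a id_blinfun W Y Z" if "clinear_op Y" for Y
    using W that by (simp add: nc_domain_id)
  have "defect a M k = V' o\<^sub>L defect a W k o\<^sub>L V"
  proof (induction k)
    case 0
    show ?case
      by (rule blinfun_eqI) simp
  next
    case (Suc k)
    have "clinear_op (defect a W k)"
      by (rule defect_clinear[OF exW assms(2)])
    then obtain Z where Z: "is_Phi a id_blinfun W (defect a W k) Z"
      using exW by blast
    have "Phi a id_blinfun M (defect a M k) = V' o\<^sub>L Z o\<^sub>L V"
      unfolding Suc by (rule Phi_eq[OF is_Phi_compress[OF assms(1,2) Z]])
    then show ?case
      using Suc by (simp add: Phi_eq[OF Z]) (rule blinfun_eqI, simp add: blinfun.diff_left blinfun.diff_right)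
  qed
  moreover have "positive_op (defect a W k)"
    using W k by (simp add: nc_domain_id)
  ultimately show "positive_op (defect a M k)"
    by (simp add: positive_op_def cinner_V')
qed

section \<open>Inflation to the large space\<close>

definition inflate :: "('e \<Rightarrow>\<^sub>L 'e) \<Rightarrow> ('h \<Rightarrow>\<^sub>L 'h)" where
  "inflate T = V o\<^sub>L T o\<^sub>L V'"

lemma inflate_apply: "inflate T x = V (T (V' x))"
  by (simp add: inflate_def)

lemma adjoint_pair_inflate: "adjoint_pair T S \<Longrightarrow> adjoint_pair (inflate T) (inflate S)"
  by (simp add: adjoint_pair_def inflate_apply cinner_V cinner_V')

lemma coinvariant_inflate: "coinvariant (inflate T) T"
  by (simp add: coinvariant_def inflate_apply)

text \<open>The empty word is excluded because it gives the full identity, whereas the inflated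
  identity is only the projection \<open>V V'\<close>.\<close>

lemma op_word_inflate:
  "\<alpha> \<noteq> [] \<Longrightarrow> op_word id_blinfun (\<chi> i. inflate (L $ i)) \<alpha> = inflate (op_word id_blinfun L \<alpha>)"
proof (induction \<alpha>)
  case (Cons i \<alpha>)
  then show ?case
    by (cases "\<alpha> = []") (auto intro!: blinfun_eqI simp: inflate_apply)
qed simp

text \<open>Only nonempty words enter \<Phi>, and these factor through \<open>V\<close> and
  \<open>V'\<close>. So \<Phi> of an inflated tuple sees only the corner of \<open>Y\<close> and has
  its values in that corner.\<close>

lemma is_Phi_inflate:
  assumes "\<And>i. adjointable (L $ i)" and "is_Phi a id_blinfun L (V' o\<^sub>L Y o\<^sub>L V) Z"
  shows "is_Phi a id_blinfun (\<chi> i. inflate (L $ i)) Y (inflate Z)"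
proof -
  have "cinner (Phi_part a (\<chi> i. inflate (L $ i)) Y k x) y =
      cinner (Phi_part a L (V' o\<^sub>L Y o\<^sub>L V) k (V' x)) (V' y)" for k x y
    unfolding cinner_Phi_part
  proof (rule sum.cong[OF refl])
    fix \<alpha> :: "'a list"
    assume "\<alpha> \<in> {\<alpha>. length \<alpha> = Suc k}"
    then have ne: "\<alpha> \<noteq> []"
      by auto
    have "adj_op (inflate (op_word id_blinfun L \<alpha>)) = inflate (adj_op (op_word id_blinfun L \<alpha>))"
      by (intro adj_op_eq adjoint_pair_inflate adjointable_adj_op adjointable_op_word assms(1))
    then show "complex_of_real (a \<alpha>) * cinner (op_word id_blinfun (\<chi> i. inflate (L $ i)) \<alpha>
          (Y (adj_op (op_word id_blinfun (\<chi> i. inflate (L $ i)) \<alpha>) x))) y =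
        complex_of_real (a \<alpha>) * cinner (op_word id_blinfun L \<alpha>
          ((V' o\<^sub>L Y o\<^sub>L V) (adj_op (op_word id_blinfun L \<alpha>) (V' x)))) (V' y)"
      by (simp add: op_word_inflate[OF ne] inflate_apply cinner_V)
  qed
  then show ?thesis
    using assms(2) by (simp add: is_Phi_id inflate_apply cinner_V)
qed

lemma nc_domain_inflate:
  assumes "\<And>i. adjointable (L $ i)" and L: "L \<in> nc_domain a m id_blinfun"
  shows "(\<chi> i. inflate (L $ i)) \<in> nc_domain a m id_blinfun"
proof -
  define X where "X = (\<chi> i. inflate (L $ i))"
  have exL: "\<exists>Z. is_Phi a id_blinfun L Y Z" if "clinear_op Y" for Y
    using L that by (simp add: nc_domain_id)
  have "clinear_op (X $ i)" for i
    by (simp add: X_def adjoint_pair_clinear[OF adjoint_pair_inflate[OF adjointable_adj_op[OF assms(1)]]])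
  moreover have "\<exists>Z. is_Phi a id_blinfun X Y Z" if "clinear_op Y" for Y
  proof -
    have "clinear_op (V' o\<^sub>L Y o\<^sub>L V)"
      using that by (simp add: clinear_op_def V_scaleC V'_scaleC)
    then obtain Z where "is_Phi a id_blinfun L (V' o\<^sub>L Y o\<^sub>L V) Z"
      using exL by blast
    then show ?thesis
      unfolding X_def using is_Phi_inflate[of L, OF assms(1)] by blast
  qed
  moreover have "positive_op (defect a X k)" if k: "k \<in> {1..m}" for k
  proof -
    \<comment> \<open>On the complement of the range of \<open>V\<close> each defect stays the
      identity, since \<Phi> contributes nothing there.\<close>
    have eq: "defect a X k = inflate (defect a L k) + (id_blinfun - inflate id_blinfun)" for k
    proof (induction k)
      case 0
      show ?case
        by (rule blinfun_eqI) simp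
    next
      case (Suc k)
      have cl: "clinear_op (defect a L k)"
        by (rule defect_clinear[OF exL assms(1)])
      then obtain Z where Z: "is_Phi a id_blinfun L (defect a L k) Z"
        using exL by blast
      \<comment> \<open>The complement term disappears because \<open>V' V\<close> is the
        identity.\<close>
      have "V' o\<^sub>L defect a X k o\<^sub>L V = defect a L k"
        unfolding Suc
        by (rule blinfun_eqI)
          (simp add: inflate_apply blinfun.add_left blinfun.diff_left blinfun.add_right blinfun.diff_right)
      then have "is_Phi a id_blinfun X (defect a X k) (inflate Z)"
        unfolding X_def by (intro is_Phi_inflate[OF assms(1)]) (simp add: Z)
      then have "defect a X (Suc k) = defect a X k - inflate Z"
        by (simp add: Phi_eq)
      also have "\<dots> = inflate (defect a L (Suc k)) + (id_blinfun - inflate id_blinfun)"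
        unfolding Suc
        by (rule blinfun_eqI)
          (simp add: Phi_eq[OF Z] inflate_apply blinfun.add_left blinfun.diff_left blinfun.diff_right)
      finally show ?case .
    qed
    \<comment> \<open>The complement adds the difference of the squared norms of \<open>x\<close>
      and \<open>V' x\<close>, which is nonnegative because \<open>V'\<close> is a
      contraction.\<close>
    have "cinner (defect a X k x) x = cinner (defect a L k (V' x)) (V' x) +
        complex_of_real ((norm x)\<^sup>2 - (norm (V' x))\<^sup>2)" for x
      unfolding eq
      by (simp add: inflate_apply blinfun.add_left blinfun.diff_left cinner.add_left cinner.diff_left
          cinner_V cinner_self)
    moreover have "(norm (V' x))\<^sup>2 \<le> (norm x)\<^sup>2" for x
      by (intro power_mono norm_V'_le) simp
    moreover have "positive_op (defect a L k)"
      using L k by (simp add: nc_domain_id)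
    ultimately show ?thesis
      unfolding positive_op_def by (simp del: of_real_power of_real_diff)
  qed
  ultimately show ?thesis
    unfolding nc_domain_id X_def by blast
qed

end

section \<open>Operators on \<open>\<complex>\<^sup>p\<close> and matrices\<close>

lemma bounded_linear_vec_lambda:
  fixes f :: "'i::finite \<Rightarrow> 'a::real_normed_vector \<Rightarrow> 'b::real_normed_vector"
  assumes "\<And>i. bounded_linear (f i)"
  shows "bounded_linear (\<lambda>x. \<chi> i. f i x)"
proof -
  obtain K where K: "\<And>i x. norm (f i x) \<le> norm x * K i"
    using bounded_linear.bounded[OF assms] by metis
  show ?thesis
  proof (rule bounded_linear_intro)
    fix x y r
    show "(\<chi> i. f i (x + y)) = (\<chi> i. f i x) + (\<chi> i. f i y)"
      by (simp add: vec_eq_iff linear_add[OF bounded_linear.linear[OF assms]])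
    show "(\<chi> i. f i (r *\<^sub>R x)) = r *\<^sub>R (\<chi> i. f i x)"
      by (simp add: vec_eq_iff linear_scale[OF bounded_linear.linear[OF assms]])
    have "norm (\<chi> i. f i x) \<le> (\<Sum>i\<in>UNIV. norm (f i x))"
      unfolding norm_vec_def by (rule order_trans[OF L2_set_le_sum]) auto
    also have "\<dots> \<le> norm x * (\<Sum>i\<in>UNIV. K i)"
      by (simp add: sum_distrib_left K sum_mono)
    finally show "norm (\<chi> i. f i x) \<le> norm x * (\<Sum>i\<in>UNIV. K i)" .
  qed
qed

lemma vec_scaleC_axis_expansion: "x = (\<Sum>b\<in>UNIV. (x $ b) *\<^sub>C axis b (1::complex))"
  by (simp add: vec_eq_iff scaleC_vec_def scaleC_complex_def axis_def if_distrib cong: if_cong)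

definition op_matrix :: "((complex ^ 'p::finite) \<Rightarrow>\<^sub>L (complex ^ 'p)) \<Rightarrow> complex ^ 'p ^ 'p" where
  "op_matrix T = (\<chi> a b. T (axis b 1) $ a)"

lemma op_matrix_matrix_op [simp]: "op_matrix (matrix_op A) = A"
  by (simp add: op_matrix_def matrix_op_apply vec_eq_iff matrix_vector_mult_def axis_def if_distrib
      cong: if_cong)

text \<open>Complex linearity is essential: the values on the vectors \<open>axis b 1\<close> do not
  determine a merely real-linear map.\<close>

lemma matrix_op_op_matrix:
  fixes T :: "(complex ^ 'p::finite) \<Rightarrow>\<^sub>L (complex ^ 'p)"
  assumes "clinear_op T"
  shows "matrix_op (op_matrix T) = T"
proof (rule blinfun_eqI)
  fix x :: "complex ^ 'p"
  have "T x = (\<Sum>b\<in>UNIV. (x $ b) *\<^sub>C T (axis b 1))"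
    by (subst vec_scaleC_axis_expansion[of x])
      (simp add: blinfun.sum_right assms[unfolded clinear_op_def, rule_format])
  then show "matrix_op (op_matrix T) x = T x"
    by (simp add: matrix_op_apply op_matrix_def matrix_vector_mult_def vec_eq_iff scaleC_vec_def
        scaleC_complex_def mult.commute)
qed

lemma bounded_linear_op_matrix: "bounded_linear op_matrix"
  unfolding op_matrix_def
  by (intro bounded_linear_vec_lambda bounded_linear_compose[OF bounded_linear_vec_nth]
      blinfun.bounded_linear_left)

lemma op_matrix_scaleC_op: "op_matrix (scaleC_op z T) = z *\<^sub>C op_matrix T"
  by (simp add: op_matrix_def scaleC_op_apply scaleC_vec_def vec_eq_iff)

lemma bounded_linear_matrix_op: "bounded_linear (matrix_op :: complex ^ 'p::finite ^ 'p \<Rightarrow> _)"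
proof -
  have "linear (matrix_op :: complex ^ 'p ^ 'p \<Rightarrow> _)"
    by (intro linearI blinfun_eqI)
      (simp_all add: matrix_op_apply blinfun.add_left blinfun.scaleR_left
        matrix_vector_mult_def vec_eq_iff scaleR_sum_right distrib_right sum.distrib)
  then show ?thesis
    by (simp add: linear_conv_bounded_linear)
qed

lemma matrix_op_mult: "matrix_op (A ** B) = matrix_op A o\<^sub>L matrix_op B"
  by (rule blinfun_eqI) (simp add: matrix_op_apply matrix_vector_mul_assoc)

lemma matrix_op_one: "matrix_op (mat 1) = id_blinfun"
  by (rule blinfun_eqI) (simp add: matrix_op_apply)

lemma matrix_op_scaleC: "matrix_op (z *\<^sub>C A) = scaleC_op z (matrix_op A)"
  by (rule blinfun_eqI)
    (simp add: matrix_op_apply scaleC_op_apply scaleC_vec_def scaleC_complex_def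
      matrix_vector_mult_def vec_eq_iff sum_distrib_left mult.assoc)

lemma adjointable_matrix_op: "adjointable (matrix_op A)"
proof -
  have "cinner (matrix_op A x) y = cinner x (matrix_op (\<chi> i j. cnj (A $ j $ i)) y)" for x y
  proof -
    have "cinner (matrix_op A x) y = (\<Sum>i\<in>UNIV. \<Sum>j\<in>UNIV. A $ i $ j * x $ j * cnj (y $ i))"
      by (simp add: matrix_op_apply cinner_vec_def cinner_complex_def matrix_vector_mult_def sum_distrib_right)
    also have "\<dots> = (\<Sum>j\<in>UNIV. \<Sum>i\<in>UNIV. A $ i $ j * x $ j * cnj (y $ i))"
      by (rule sum.swap)
    also have "\<dots> = cinner x (matrix_op (\<chi> i j. cnj (A $ j $ i)) y)"
      by (simp add: matrix_op_apply cinner_vec_def cinner_complex_def matrix_vector_mult_def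
          sum_distrib_left mult_ac)
    finally show ?thesis .
  qed
  then show ?thesis
    unfolding adjointable_def adjoint_pair_def by blast
qed

lemma op_word_matrix_op: "op_word id_blinfun (\<chi> i. matrix_op (\<Lambda> $ i)) \<alpha> = matrix_op (matrix_word \<Lambda> \<alpha>)"
  by (induction \<alpha>) (simp_all add: matrix_word_def matrix_op_one matrix_op_mult)

lemma op_word_scaleR: "op_word id_blinfun (r *\<^sub>R X) \<alpha> = r ^ length \<alpha> *\<^sub>R op_word id_blinfun X \<alpha>"
  by (induction \<alpha>) (auto intro!: blinfun_eqI simp: blinfun.scaleR_left blinfun.scaleR_right)

section \<open>Orthonormal systems and the isometry\<close>

lemma orthonormal_sequence_exists:
  assumes "infinite_dimensional TYPE('h::complex_hilbert)"
  shows "\<exists>e::nat \<Rightarrow> 'h. \<forall>i<n. \<forall>j<n. cinner (e i) (e j) = (if i = j then 1 else 0)"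
proof (induction n)
  case (Suc n)
  then obtain e :: "nat \<Rightarrow> 'h"
    where e: "\<And>i j. i < n \<Longrightarrow> j < n \<Longrightarrow> cinner (e i) (e j) = (if i = j then 1 else 0)"
    by blast
  \<comment> \<open>\<open>infinite_dimensional\<close> speaks of sums over sets of vectors;
    injectivity turns the sum over the image into a sum over indices.\<close>
  have inj: "inj_on e {..<n}"
  proof (rule inj_onI)
    fix i j
    assume ij: "i \<in> {..<n}" "j \<in> {..<n}" "e i = e j"
    then have "cinner (e i) (e j) = 1"
      using e[of j j] by simp
    then show "i = j"
      using ij e[of i j] by (auto split: if_splits)
  qed
  obtain x where x: "\<And>u. x \<noteq> (\<Sum>b\<in>e ` {..<n}. u b *\<^sub>C b)"
    using assms unfolding infinite_dimensional_def by (metis finite_imageI finite_lessThan)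
  \<comment> \<open>Gram-Schmidt: \<open>y\<close> is nonzero because \<open>x\<close> is outside
    the span of the vectors already chosen.\<close>
  define y where "y = x - (\<Sum>i<n. cinner x (e i) *\<^sub>C e i)"
  have y0: "y \<noteq> 0"
    using x[of "cinner x"] by (simp add: y_def sum.reindex[OF inj])
  have orth: "cinner y (e j) = 0" if "j < n" for j
    using that by (simp add: y_def cinner.diff_left cinner.sum_left cinner_scaleC_left e if_distrib
        cong: if_cong)
  have orth': "cinner (e j) y = 0" if "j < n" for j
    using orth[OF that] cinner_commute[of "e j" y] by simp
  define e' where "e' = e(n := (1 / norm y) *\<^sub>R y)"
  have "cinner (e' i) (e' j) = (if i = j then 1 else 0)" if "i < Suc n" "j < Suc n" for i j
    using that y0 orth orth' e cinner_self[of y]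
    by (auto simp: e'_def less_Suc_eq cinner.scaleR_left cinner.scaleR_right
        scaleR_conv_of_real power2_eq_square)
  then show ?case
    by blast
qed simp

lemma isometry_exists:
  assumes "infinite_dimensional TYPE('h::complex_hilbert)"
  shows "\<exists>(V :: (complex ^ 'p::finite) \<Rightarrow>\<^sub>L 'h) V'. isometry V V'"
proof -
  obtain e :: "nat \<Rightarrow> 'h" where e: "\<forall>i<CARD('p). \<forall>j<CARD('p). cinner (e i) (e j) = (if i = j then 1 else 0)"
    using orthonormal_sequence_exists[OF assms] by blast
  obtain h :: "'p \<Rightarrow> nat" where h: "bij_betw h UNIV {0..<CARD('p)}"
    using ex_bij_betw_finite_nat[of "UNIV :: 'p set"] by auto
  have on: "cinner (e (h i)) (e (h j)) = (if i = j then 1 else 0)" for i j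
  proof -
    have "h i < CARD('p)" "h j < CARD('p)" "h i = h j \<longleftrightarrow> i = j"
      using h by (auto simp: bij_betw_def inj_eq)
    then show ?thesis
      using e by simp
  qed
  \<comment> \<open>\<open>v\<close> sends the standard basis to the orthonormal system, and its
    adjoint \<open>v'\<close> collects the Fourier coefficients.\<close>
  define v where "v = (\<lambda>x :: complex ^ 'p. \<Sum>i\<in>UNIV. (x $ i) *\<^sub>C e (h i))"
  define v' where "v' = (\<lambda>y. \<chi> i. cinner y (e (h i)))"
  have "(r *\<^sub>R z) *\<^sub>C y = r *\<^sub>R (z *\<^sub>C y)" for r z and y :: 'h
    by (simp add: scaleR_scaleC scaleC_scaleC scaleC_complex_def)
  then have "linear v"
    by (intro linearI) (simp_all add: v_def scaleC_add_left sum.distrib scaleR_sum_right)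
  then have v: "bounded_linear v"
    by (simp add: linear_conv_bounded_linear)
  have v': "bounded_linear v'"
    unfolding v'_def by (intro bounded_linear_vec_lambda cinner.bounded_linear_left)
  have "isometry (Blinfun v) (Blinfun v')"
  proof
    show "adjoint_pair (Blinfun v) (Blinfun v')"
      unfolding adjoint_pair_def bounded_linear_Blinfun_apply[OF v] bounded_linear_Blinfun_apply[OF v']
      by (auto simp: v_def v'_def cinner_vec_def cinner_complex_def cinner.sum_left cinner_scaleC_left
          cinner_commute[of "e _", symmetric])
    show "Blinfun v' (Blinfun v x) = x" for x
      unfolding bounded_linear_Blinfun_apply[OF v] bounded_linear_Blinfun_apply[OF v']
      by (simp add: v_def v'_def vec_eq_iff cinner.sum_left cinner_scaleC_left on if_distrib cong: if_cong)
  qed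
  then show ?thesis
    by blast
qed

section \<open>The matrix representation of a free holomorphic map\<close>

locale frame = isometry V V'
  for V :: "(complex ^ 'p::finite) \<Rightarrow>\<^sub>L 'h::complex_hilbert" and V' :: "'h \<Rightarrow>\<^sub>L (complex ^ 'p)"
begin

definition compression :: "('h \<Rightarrow>\<^sub>L 'h) \<Rightarrow> complex ^ 'p ^ 'p" where
  "compression T = op_matrix (V' o\<^sub>L T o\<^sub>L V)"

definition embed :: "complex ^ 'p ^ 'p ^ 'n \<Rightarrow> ('h \<Rightarrow>\<^sub>L 'h) ^ 'n::finite" where
  "embed \<Lambda> = (\<chi> i. inflate (matrix_op (\<Lambda> $ i)))"

lemma bounded_linear_corner: "bounded_linear (\<lambda>T. V' o\<^sub>L T o\<^sub>L V)"
  by (intro bounded_linear_compose[OF bounded_bilinear.bounded_linear_left[OF bounded_bilinear_blinfun_compose]]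
      bounded_bilinear.bounded_linear_right[OF bounded_bilinear_blinfun_compose])

lemma bounded_linear_inflate: "bounded_linear inflate"
  unfolding inflate_def
  by (intro bounded_linear_compose[OF bounded_bilinear.bounded_linear_left[OF bounded_bilinear_blinfun_compose]]
      bounded_bilinear.bounded_linear_right[OF bounded_bilinear_blinfun_compose])

lemma bounded_linear_compression: "bounded_linear compression"
  unfolding compression_def
  by (rule bounded_linear_compose[OF bounded_linear_op_matrix bounded_linear_corner])

lemma bounded_linear_embed: "bounded_linear embed"
  unfolding embed_def
  by (intro bounded_linear_vec_lambda bounded_linear_compose[OF bounded_linear_inflate]
      bounded_linear_compose[OF bounded_linear_matrix_op] bounded_linear_vec_nth)

lemma compression_scaleC_op: "compression (scaleC_op z T) = z *\<^sub>C compression T"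
proof -
  have "V' o\<^sub>L scaleC_op z T o\<^sub>L V = scaleC_op z (V' o\<^sub>L T o\<^sub>L V)"
    by (rule blinfun_eqI) (simp add: scaleC_op_apply V'_scaleC)
  then show ?thesis
    by (simp add: compression_def op_matrix_scaleC_op)
qed

lemma coinvariant_embed: "coinvariant (embed \<Lambda> $ i) (matrix_op (\<Lambda> $ i))"
  by (simp add: embed_def coinvariant_inflate)

lemma adjointable_embed: "adjointable (embed \<Lambda> $ i)"
  using adjoint_pair_inflate[OF adjointable_adj_op[OF adjointable_matrix_op]]
  by (auto simp: embed_def adjointable_def)

lemma compression_coinvariant:
  assumes "coinvariant T (matrix_op A)"
  shows "compression T = A"
proof -
  have "V' o\<^sub>L T o\<^sub>L V = matrix_op A"
    using assms by (intro blinfun_eqI) (simp add: coinvariant_def)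
  then show ?thesis
    by (simp add: compression_def)
qed

lemma embed_mem_iff: "embed \<Lambda> \<in> nc_domain a m id_blinfun \<longleftrightarrow> \<Lambda> \<in> matrix_domain a m"
proof
  assume "embed \<Lambda> \<in> nc_domain a m id_blinfun"
  then show "\<Lambda> \<in> matrix_domain a m"
    unfolding matrix_domain_def mem_Collect_eq
    by (rule nc_domain_compress[rotated 2]) (simp_all add: coinvariant_embed adjointable_embed)
next
  assume "\<Lambda> \<in> matrix_domain a m"
  then have "(\<chi> i. inflate ((\<chi> i. matrix_op (\<Lambda> $ i)) $ i)) \<in> nc_domain a m id_blinfun"
    unfolding matrix_domain_def mem_Collect_eq
    by (intro nc_domain_inflate) (simp_all add: adjointable_matrix_op)
  then show "embed \<Lambda> \<in> nc_domain a m id_blinfun"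
    by (simp add: embed_def)
qed

text \<open>Coinvariance makes compression multiplicative on words, so the radius \<open>r\<close>
  and the coefficients pass through linearly.\<close>

lemma compression_homogeneous_part:
  assumes "\<And>i. coinvariant (W $ i) (matrix_op (M $ i))"
  shows "compression (homogeneous_part c id_blinfun (r *\<^sub>R W) k) = matrix_part c M r k"
proof -
  interpret compression: bounded_linear compression
    by (rule bounded_linear_compression)
  have "coinvariant (op_word id_blinfun W \<alpha>) (matrix_op (matrix_word M \<alpha>))" for \<alpha>
    using coinvariant_op_word[of W "\<chi> i. matrix_op (M $ i)"] assms by (simp add: op_word_matrix_op)
  then have "compression (op_word id_blinfun W \<alpha>) = matrix_word M \<alpha>" for \<alpha>
    by (rule compression_coinvariant)
  then show ?thesis
    by (simp add: homogeneous_part_def matrix_part_def compression.sum compression_scaleC_op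
        op_word_scaleR compression.scaleR scaleR_scaleC scaleC_scaleC)
qed

text \<open>\<open>W\<close> is any tuple coinvariant over \<open>M\<close>, not just
  \<open>embed M\<close>. The lemma is used for \<open>F\<close> at \<open>embed \<Lambda>\<close>
  and for \<open>G\<close> at \<open>F (embed \<Lambda>)\<close>, which need not be
  inflated.\<close>

lemma matrix_map_limit:
  assumes W: "W \<in> nc_domain a m id_blinfun"
    and cont: "continuous_on (nc_domain a m id_blinfun) F"
    and star: "starlike_at_0 (nc_domain a m (id_blinfun :: 'h \<Rightarrow>\<^sub>L 'h))"
    and rep: "free_holomorphic_rep K a m c F"
    and coinv: "\<And>i. coinvariant (W $ i) (matrix_op (M $ i))"
  shows "r \<in> {0..<1} \<Longrightarrow> matrix_part (c j) M r sums compression (F (r *\<^sub>R W) $ j)"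
    and "((\<lambda>r. F (r *\<^sub>R W) $ j) \<longlongrightarrow> F W $ j) (at_left 1)"
    and "((\<lambda>r. \<Sum>k. matrix_part (c j) M r k) \<longlongrightarrow> compression (F W $ j)) (at_left 1)"
    and "matrix_map c M $ j = compression (F W $ j)"
proof -
  show sums: "matrix_part (c j) M r sums compression (F (r *\<^sub>R W) $ j)" if "r \<in> {0..<1}" for r
  proof -
    have "r *\<^sub>R W \<in> nc_domain_rad a m id_blinfun"
      using W that by (auto simp: nc_domain_rad_def)
    then have "homogeneous_part (c j) id_blinfun (r *\<^sub>R W) sums (F (r *\<^sub>R W) $ j)"
      using rep by (simp add: free_holomorphic_rep_def)
    from bounded_linear.sums[OF bounded_linear_compression this] show ?thesis
      by (simp add: compression_homogeneous_part[OF coinv])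
  qed
  have ev: "\<forall>\<^sub>F r in at_left (1::real). r \<in> {0..<1}"
    by (rule eventually_at_leftI[of 0]) auto
  \<comment> \<open>Starlikeness keeps the segment \<open>r W\<close> inside the domain, and
    \<open>F\<close> is norm-continuous up to \<open>W\<close> itself, which may lie on the
    boundary.\<close>
  have "((\<lambda>r. r *\<^sub>R W) \<longlongrightarrow> 1 *\<^sub>R W) (at_left 1)"
    by (intro tendsto_intros)
  then have "((\<lambda>r. F (r *\<^sub>R W)) \<longlongrightarrow> F W) (at_left 1)"
    using cont W star ev unfolding starlike_at_0_def
    by (intro continuous_on_tendsto_compose[OF cont]) (auto elim: eventually_mono)
  then show lim: "((\<lambda>r. F (r *\<^sub>R W) $ j) \<longlongrightarrow> F W $ j) (at_left 1)"
    by (rule tendsto_vec_nth)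
  have "((\<lambda>r. compression (F (r *\<^sub>R W) $ j)) \<longlongrightarrow> compression (F W $ j)) (at_left 1)"
    by (rule bounded_linear.tendsto[OF bounded_linear_compression lim])
  moreover have "\<forall>\<^sub>F r in at_left 1. compression (F (r *\<^sub>R W) $ j) = (\<Sum>k. matrix_part (c j) M r k)"
    using ev by eventually_elim (rule sums_unique[OF sums])
  ultimately show lim': "((\<lambda>r. \<Sum>k. matrix_part (c j) M r k) \<longlongrightarrow> compression (F W $ j)) (at_left 1)"
    by (rule Lim_transform_eventually)
  then show "matrix_map c M $ j = compression (F W $ j)"
    by (simp add: matrix_map_def tendsto_Lim)
qed

text \<open>The image of an inflated tuple is \<open>F\<^sub>p(\<Lambda>) \<oplus> c\<^sub>0 I\<close>, so the range of \<open>V\<close> still reduces it.\<close>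

lemma image_embed_split:
  assumes \<Lambda>: "\<Lambda> \<in> matrix_domain a m"
    and cont: "continuous_on (nc_domain a m id_blinfun) F"
    and star: "starlike_at_0 (nc_domain a m (id_blinfun :: 'h \<Rightarrow>\<^sub>L 'h))"
    and rep: "free_holomorphic_rep K a m c F"
  shows "F (embed \<Lambda>) $ j = inflate (V' o\<^sub>L F (embed \<Lambda>) $ j o\<^sub>L V) +
    scaleC_op (c j []) (id_blinfun - inflate id_blinfun)"
proof -
  \<comment> \<open>\<open>\<phi>\<close> removes the corner of an operator. It annihilates every
    inflated operator, hence all nonempty words in \<open>embed \<Lambda>\<close>, and only the
    constant term survives.\<close>
  define \<phi> where "\<phi> = (\<lambda>T. T - inflate (V' o\<^sub>L T o\<^sub>L V))"
  have bl: "bounded_linear \<phi>"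
    unfolding \<phi>_def
    by (intro bounded_linear_sub bounded_linear_ident bounded_linear_compose[OF bounded_linear_inflate]
        bounded_linear_corner)
  interpret \<phi>: bounded_linear \<phi>
    by (rule bl)
  define Q where "Q = scaleC_op (c j []) (id_blinfun - inflate id_blinfun)"
  note W = embed_mem_iff[THEN iffD2, OF \<Lambda>]
  have scale: "\<phi> (scaleC_op z T) = scaleC_op z (\<phi> T)" for z T
    by (rule blinfun_eqI)
      (simp add: \<phi>_def scaleC_op_apply blinfun.diff_left inflate_apply V_scaleC V'_scaleC
        linear_diff[OF bounded_linear.linear[OF bounded_linear_scaleC]])
  have part: "\<phi> (homogeneous_part (c j) id_blinfun (r *\<^sub>R embed \<Lambda>) k) = (if k = 0 then Q else 0)" for r k
  proof (cases k)
    case 0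
    have "{\<alpha> :: 'a list. \<alpha> = []} = {[]}"
      by auto
    then show ?thesis
      using 0 by (simp add: homogeneous_part_def Q_def scale)
        (rule arg_cong[where f = "scaleC_op _"], rule blinfun_eqI,
          simp add: \<phi>_def blinfun.diff_left inflate_apply)
  next
    case (Suc k')
    have "\<phi> (scaleC_op (c j \<alpha>) (op_word id_blinfun (r *\<^sub>R embed \<Lambda>) \<alpha>)) = 0" if "length \<alpha> = k" for \<alpha>
    proof -
      have "\<alpha> \<noteq> []"
        using that Suc by auto
      then have "op_word id_blinfun (embed \<Lambda>) \<alpha> = inflate (matrix_op (matrix_word \<Lambda> \<alpha>))"
        using op_word_inflate[of \<alpha> "\<chi> i. matrix_op (\<Lambda> $ i)"] by (simp add: embed_def op_word_matrix_op)
      then have "\<phi> (op_word id_blinfun (embed \<Lambda>) \<alpha>) = 0"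
        by (intro blinfun_eqI) (simp add: \<phi>_def inflate_apply blinfun.diff_left)
      then show ?thesis
        unfolding scale op_word_scaleR \<phi>.scaleR
        by (intro blinfun_eqI) (simp add: scaleC_op_apply)
    qed
    then show ?thesis
      using Suc by (simp add: homogeneous_part_def \<phi>.sum)
  qed
  have "\<phi> (F (r *\<^sub>R embed \<Lambda>) $ j) = Q" if "r \<in> {0..<1}" for r
  proof -
    have "r *\<^sub>R embed \<Lambda> \<in> nc_domain_rad a m id_blinfun"
      using W that by (auto simp: nc_domain_rad_def)
    then have "homogeneous_part (c j) id_blinfun (r *\<^sub>R embed \<Lambda>) sums (F (r *\<^sub>R embed \<Lambda>) $ j)"
      using rep by (simp add: free_holomorphic_rep_def)
    then have "(\<lambda>k. if k = 0 then Q else 0) sums \<phi> (F (r *\<^sub>R embed \<Lambda>) $ j)"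
      using \<phi>.sums[of "homogeneous_part (c j) id_blinfun (r *\<^sub>R embed \<Lambda>)"] by (simp add: part)
    then show ?thesis
      using sums_single[of 0 "\<lambda>_. Q"] sums_unique2 by blast
  qed
  \<comment> \<open>The off-corner part is the constant \<open>Q\<close> for all radii below 1, so
    it is still \<open>Q\<close> in the limit.\<close>
  then have "\<forall>\<^sub>F r in at_left 1. \<phi> (F (r *\<^sub>R embed \<Lambda>) $ j) = Q"
    by (intro eventually_at_leftI[of 0]) auto
  moreover have "((\<lambda>r. \<phi> (F (r *\<^sub>R embed \<Lambda>) $ j)) \<longlongrightarrow> \<phi> (F (embed \<Lambda>) $ j)) (at_left 1)"
    by (rule \<phi>.tendsto[OF matrix_map_limit(2)[OF W cont star rep coinvariant_embed]])
  ultimately have "((\<lambda>r. Q) \<longlongrightarrow> \<phi> (F (embed \<Lambda>) $ j)) (at_left (1::real))"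
    by (rule Lim_transform_eventually[rotated])
  then have "\<phi> (F (embed \<Lambda>) $ j) = Q"
    using tendsto_unique[OF trivial_limit_at_left_real] tendsto_const by blast
  then show ?thesis
    by (simp add: \<phi>_def Q_def algebra_simps)
qed

text \<open>Both claims are read off the block form. It gives coinvariance, and it also exhibits an
  adjoint of the image tuple, which compression to the matrix domain requires.\<close>

lemma
  assumes \<Lambda>: "\<Lambda> \<in> matrix_domain a m"
    and cont: "continuous_on (nc_domain a m id_blinfun) F"
    and star: "starlike_at_0 (nc_domain a m (id_blinfun :: 'h \<Rightarrow>\<^sub>L 'h))"
    and rep: "free_holomorphic_rep K a m c F"
    and maps: "F (embed \<Lambda>) \<in> nc_domain b l id_blinfun"
  shows coinvariant_image_embed: "coinvariant (F (embed \<Lambda>) $ j) (matrix_op (matrix_map c \<Lambda> $ j))"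
    and matrix_map_in_matrix_domain: "matrix_map c \<Lambda> \<in> matrix_domain b l"
proof -
  define S where "S = (\<lambda>j. V' o\<^sub>L F (embed \<Lambda>) $ j o\<^sub>L V)"
  have split: "F (embed \<Lambda>) $ j = inflate (S j) + scaleC_op (c j []) (id_blinfun - inflate id_blinfun)" for j
    unfolding S_def by (rule image_embed_split[OF \<Lambda> cont star rep])
  \<comment> \<open>Membership in the target domain supplies complex linearity, without which the
    corner could not be recovered from its matrix.\<close>
  have "clinear_op (S j)" for j
    using maps by (simp add: S_def nc_domain_id clinear_op_def V_scaleC V'_scaleC)
  then have "matrix_op (compression (F (embed \<Lambda>) $ j)) = S j" for j
    unfolding compression_def by (simp add: S_def matrix_op_op_matrix)
  then have S: "S j = matrix_op (matrix_map c \<Lambda> $ j)" for j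
    using matrix_map_limit(4)[OF embed_mem_iff[THEN iffD2, OF \<Lambda>] cont star rep coinvariant_embed] by simp
  show coinv: "coinvariant (F (embed \<Lambda>) $ j) (matrix_op (matrix_map c \<Lambda> $ j))" for j
    unfolding coinvariant_def S[symmetric]
    by (subst split) (simp add: blinfun.add_left blinfun.add_right blinfun.diff_left blinfun.diff_right
        scaleC_op_apply inflate_apply V'_scaleC)
  have adj: "adjointable (F (embed \<Lambda>) $ j)" for j
    unfolding split S adjointable_def
    using adjoint_pair_add[OF adjoint_pair_inflate[OF adjointable_adj_op[OF adjointable_matrix_op]]
        adjoint_pair_scaleC_op[OF adjoint_pair_diff[OF adjoint_pair_id adjoint_pair_inflate[OF adjoint_pair_id]]]]
    by blast
  show "matrix_map c \<Lambda> \<in> matrix_domain b l"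
    unfolding matrix_domain_def mem_Collect_eq
    by (rule nc_domain_compress[OF _ adj maps]) (simp add: coinv)
qed

text \<open>Image, continuity and left inverse are bundled so that one more application, with
  \<open>F\<close> and \<open>G\<close> exchanged, completes the homeomorphism.\<close>

lemma matrix_map_left_inverse:
  assumes hom: "homeomorphism (nc_domain a m (id_blinfun :: 'h \<Rightarrow>\<^sub>L 'h)) (nc_domain b l id_blinfun) F G"
    and starF: "starlike_at_0 (nc_domain a m (id_blinfun :: 'h \<Rightarrow>\<^sub>L 'h))"
    and starG: "starlike_at_0 (nc_domain b l (id_blinfun :: 'h \<Rightarrow>\<^sub>L 'h))"
    and repF: "free_holomorphic_rep K a m c F"
    and repG: "free_holomorphic_rep K b l d G"
  shows "matrix_map c ` (matrix_domain a m :: (complex ^ 'p ^ 'p ^ _) set) \<subseteq> matrix_domain b l \<and>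
    continuous_on (matrix_domain a m :: (complex ^ 'p ^ 'p ^ _) set) (matrix_map c) \<and>
    (\<forall>\<Lambda>\<in>(matrix_domain a m :: (complex ^ 'p ^ 'p ^ _) set). matrix_map d (matrix_map c \<Lambda>) = \<Lambda>)"
proof (intro conjI ballI image_subsetI)
  have contF: "continuous_on (nc_domain a m id_blinfun) F"
    and contG: "continuous_on (nc_domain b l id_blinfun) G"
    using hom by (auto simp: homeomorphism_def)
  have maps: "F (embed \<Lambda>) \<in> nc_domain b l id_blinfun" if "\<Lambda> \<in> matrix_domain a m" for \<Lambda>
    using hom embed_mem_iff[THEN iffD2, OF that] unfolding homeomorphism_def by blast
  have eq: "matrix_map c \<Lambda> = (\<chi> j. compression (F (embed \<Lambda>) $ j))" if "\<Lambda> \<in> matrix_domain a m" for \<Lambda>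
    using matrix_map_limit(4)[OF embed_mem_iff[THEN iffD2, OF that] contF starF repF coinvariant_embed]
    by (simp add: vec_eq_iff)
  have "continuous_on (matrix_domain a m) (\<lambda>\<Lambda>. F (embed \<Lambda>))"
    by (rule continuous_on_compose2[OF contF]) (auto simp: embed_mem_iff intro!:
        linear_continuous_on bounded_linear_embed)
  then have "continuous_on (matrix_domain a m) (\<lambda>\<Lambda>. \<chi> j. compression (F (embed \<Lambda>) $ j))"
    by (intro continuous_on_vec_lambda bounded_linear.continuous_on[OF bounded_linear_compression]
        continuous_on_component)
  then show "continuous_on (matrix_domain a m :: (complex ^ 'p ^ 'p ^ _) set) (matrix_map c)"
    by (rule continuous_on_eq) (simp add: eq)
  fix \<Lambda> :: "complex ^ 'p ^ 'p ^ _"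
  assume \<Lambda>: "\<Lambda> \<in> matrix_domain a m"
  show "matrix_map c \<Lambda> \<in> matrix_domain b l"
    by (rule matrix_map_in_matrix_domain[OF \<Lambda> contF starF repF maps[OF \<Lambda>]])
  have GF: "G (F (embed \<Lambda>)) = embed \<Lambda>"
    using hom embed_mem_iff[THEN iffD2, OF \<Lambda>] by (auto simp: homeomorphism_def)
  \<comment> \<open>The series \<open>d\<close> at \<open>matrix_map c \<Lambda>\<close> is
    evaluated through \<open>G\<close> at \<open>F (embed \<Lambda>)\<close>. That tuple may differ
    from \<open>embed (matrix_map c \<Lambda>)\<close>, but it is coinvariant over the same
    matrices, so the compressed limit is the same.\<close>
  have "matrix_map d (matrix_map c \<Lambda>) $ i = compression (embed \<Lambda> $ i)" for i
    using matrix_map_limit(4)[OF maps[OF \<Lambda>] contG starG repG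
        coinvariant_image_embed[OF \<Lambda> contF starF repF maps[OF \<Lambda>]]]
    by (simp add: GF)
  then show "matrix_map d (matrix_map c \<Lambda>) = \<Lambda>"
    by (simp add: vec_eq_iff compression_coinvariant[OF coinvariant_embed])
qed

lemma matrix_map_homeomorphism:
  assumes hom: "homeomorphism (nc_domain a m (id_blinfun :: 'h \<Rightarrow>\<^sub>L 'h)) (nc_domain b l id_blinfun) F G"
    and starF: "starlike_at_0 (nc_domain a m (id_blinfun :: 'h \<Rightarrow>\<^sub>L 'h))"
    and starG: "starlike_at_0 (nc_domain b l (id_blinfun :: 'h \<Rightarrow>\<^sub>L 'h))"
    and repF: "free_holomorphic_rep K a m c F"
    and repG: "free_holomorphic_rep K b l d G"
  shows "homeomorphism (matrix_domain a m :: (complex ^ 'p ^ 'p ^ _) set) (matrix_domain b l) (matrix_map c) (matrix_map d)"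
proof -
  note F = matrix_map_left_inverse[OF hom starF starG repF repG]
  note G = matrix_map_left_inverse[OF homeomorphism_symD[OF hom] starG starF repG repF]
  show ?thesis
    by (intro homeomorphismI) (use F G in auto)
qed

end

section \<open>Circularity and a neighbourhood of the origin\<close>

lemma op_word_rotate:
  assumes "\<And>i. adjointable (X $ i)"
  shows "op_word id_blinfun (\<chi> i. scaleC_op u (X $ i)) \<alpha> =
    scaleC_op (u ^ length \<alpha>) (op_word id_blinfun X \<alpha>)"
proof (induction \<alpha>)
  case (Cons i \<alpha>)
  then show ?case
    using adjoint_pair_scaleC[OF adjointable_adj_op[OF assms[of i]]]
    by (intro blinfun_eqI) (simp add: scaleC_op_apply scaleC_scaleC)
qed (auto intro!: blinfun_eqI simp: scaleC_op_apply)

text \<open>A word of length \<open>k\<close> contributes \<open>u ^ k\<close> and its adjoint the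
  conjugate. They cancel once the scalar is moved through the complex-linear
  \<open>Y\<close>.\<close>

lemma is_Phi_rotate:
  assumes "\<And>i. adjointable (X $ i)" "clinear_op Y" "cmod u = 1"
  shows "is_Phi a id_blinfun (\<chi> i. scaleC_op u (X $ i)) Y Z \<longleftrightarrow> is_Phi a id_blinfun X Y Z"
proof -
  let ?W = "op_word id_blinfun X"
  have "cinner (Phi_part a (\<chi> i. scaleC_op u (X $ i)) Y k x) y = cinner (Phi_part a X Y k x) y" for k x y
    unfolding cinner_Phi_part
  proof (intro sum.cong refl arg_cong2[where f = "(*)"])
    fix \<alpha> :: "'a list"
    define v where "v = u ^ length \<alpha>"
    have v: "v * cnj v = 1"
      using assms(3) by (simp add: v_def power_mult_distrib[symmetric] complex_norm_square[symmetric])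
    note adj = adjointable_adj_op[OF adjointable_op_word[of X \<alpha>, OF assms(1)]]
    have "scaleC_op v (?W \<alpha>) (Y (scaleC_op (cnj v) (adj_op (?W \<alpha>)) x)) = ?W \<alpha> (Y (adj_op (?W \<alpha>) x))"
      using assms(2) v by (simp add: scaleC_op_apply clinear_op_def adjoint_pair_scaleC[OF adj] scaleC_scaleC)
    then show "cinner (op_word id_blinfun (\<chi> i. scaleC_op u (X $ i)) \<alpha>
          (Y (adj_op (op_word id_blinfun (\<chi> i. scaleC_op u (X $ i)) \<alpha>) x))) y =
        cinner (?W \<alpha> (Y (adj_op (?W \<alpha>) x))) y"
      unfolding op_word_rotate[of X, OF assms(1)] v_def[symmetric]
      by (simp add: adj_op_eq[OF adjoint_pair_scaleC_op[OF adj]])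
  qed
  then show ?thesis
    by (simp add: is_Phi_id)
qed

lemma nc_domain_rotate:
  assumes adj: "\<And>i. adjointable (X $ i)" and X: "X \<in> nc_domain a m id_blinfun" and u: "cmod u = 1"
  shows "(\<chi> i. scaleC_op u (X $ i)) \<in> nc_domain a m id_blinfun"
proof -
  let ?uX = "\<chi> i. scaleC_op u (X $ i)"
  have ex: "\<exists>Z. is_Phi a id_blinfun X Y Z" if "clinear_op Y" for Y
    using X that by (simp add: nc_domain_id)
  have defect: "defect a ?uX k = defect a X k" for k
  proof (induction k)
    case (Suc k)
    have "clinear_op (defect a X k)"
      by (rule defect_clinear[OF ex adj])
    then obtain Z where Z: "is_Phi a id_blinfun X (defect a X k) Z"
      using ex by blast
    then have "is_Phi a id_blinfun ?uX (defect a X k) Z"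
      using is_Phi_rotate[of X, OF adj \<open>clinear_op (defect a X k)\<close> u] by blast
    then have "Phi a id_blinfun ?uX (defect a X k) = Phi a id_blinfun X (defect a X k)"
      by (simp add: Phi_eq[OF Z] Phi_eq)
    then show ?case
      using Suc by simp
  qed simp
  have "clinear_op (?uX $ i)" for i
    using adjoint_pair_clinear[OF adjoint_pair_scaleC_op[OF adjointable_adj_op[OF adj]]] by simp
  moreover have "\<exists>Z. is_Phi a id_blinfun ?uX Y Z" if "clinear_op Y" for Y
    using ex[OF that] is_Phi_rotate[of X, OF adj that u] by blast
  ultimately show ?thesis
    using X unfolding nc_domain_id defect by blast
qed

lemma matrix_domain_rotate:
  assumes "\<Lambda> \<in> matrix_domain a m" "cmod u = 1"
  shows "u *\<^sub>C \<Lambda> \<in> matrix_domain a m"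
  using nc_domain_rotate[of "\<chi> i. matrix_op (\<Lambda> $ i)" a m u] assms
  by (simp add: matrix_domain_def adjointable_matrix_op scaleC_vec_def matrix_op_scaleC[unfolded scaleC_vec_def])

text \<open>Polar form: the phase is absorbed by rotation invariance and the modulus by
  starlikeness.\<close>

lemma matrix_domain_disc:
  fixes \<Lambda> :: "complex ^ 'p::finite ^ 'p ^ 'n::finite"
  assumes "starlike_at_0 (matrix_domain a m :: (complex ^ 'p ^ 'p ^ 'n) set)" "\<Lambda> \<in> matrix_domain a m" "cmod z \<le> 1"
  shows "z *\<^sub>C \<Lambda> \<in> matrix_domain a m"
proof (cases "cmod z = 1")
  case True
  then show ?thesis
    using assms by (simp add: matrix_domain_rotate)
next
  case False
  \<comment> \<open>\<open>sgn 0\<close> is 0 and hence not a phase, so the value 1 is chosen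
    there.\<close>
  define u where "u = (if z = 0 then 1 else sgn z)"
  have u: "cmod u = 1"
    by (simp add: u_def norm_sgn)
  have z: "z = complex_of_real (cmod z) * u"
    by (simp add: u_def sgn_eq)
  have "cmod z *\<^sub>R (u *\<^sub>C \<Lambda>) \<in> matrix_domain a m"
    using assms False u matrix_domain_rotate[of \<Lambda> a m u] unfolding starlike_at_0_def
    by (auto simp: order_less_le)
  then show ?thesis
    by (simp add: scaleR_scaleC scaleC_scaleC z[symmetric])
qed

section \<open>Coefficient growth and a neighbourhood of zero\<close>

lemma finite_words: "finite {\<alpha> :: 'n::finite list. length \<alpha> = k}"
  using finite_lists_length_eq[of "UNIV :: 'n set" k] by simp

lemma card_words: "card {\<alpha> :: 'n::finite list. length \<alpha> = k} = CARD('n) ^ k"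
  using card_lists_length_eq[of "UNIV :: 'n set" k] by simp

text \<open>The root condition bounds each coefficient of large degree \<open>k\<close> by a power
  \<open>D ^ k\<close>. There are \<open>CARD('n) ^ k\<close> words of that length, hence the base
  \<open>B\<close>.\<close>

lemma positive_regular_bound:
  fixes a :: "'n::finite list \<Rightarrow> real"
  assumes "positive_regular a"
  obtains A B where "A > 0" "B > 0" "\<And>k. (\<Sum>\<alpha> | length \<alpha> = k. a \<alpha>) \<le> A * B ^ k"
proof -
  have a0: "0 \<le> a \<alpha>" for \<alpha>
    using assms by (simp add: positive_regular_def)
  define S where "S = (\<lambda>k. \<Sum>\<alpha> | length \<alpha> = k. \<bar>a \<alpha>\<bar>\<^sup>2)"
  have "limsup (\<lambda>k. ereal (root (2 * k) (S k))) < \<infinity>"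
    using assms by (simp add: positive_regular_def S_def)
  then obtain C where "limsup (\<lambda>k. ereal (root (2 * k) (S k))) < ereal C"
    using ereal_dense2 by blast
  then have "\<forall>\<^sub>F k in sequentially. root (2 * k) (S k) < C"
    by (auto dest: Limsup_lessD)
  then obtain N where N: "\<And>k. k \<ge> N \<Longrightarrow> root (2 * k) (S k) < C"
    by (auto simp: eventually_sequentially)
  define D where "D = max C 1"
  define B where "B = real (CARD('n)) * D"
  have card1: "1 \<le> real (CARD('n))"
    by (simp add: Suc_le_eq)
  have D1: "1 \<le> D" and B1: "1 \<le> B"
    using mult_mono[OF card1, of 1 D] by (auto simp: D_def B_def)
  \<comment> \<open>\<open>A\<close> absorbs the finitely many degrees up to \<open>N\<close>,
    including degree 0, where the root of index \<open>2 * k\<close> carries no information.\<close>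
  define A where "A = 1 + (\<Sum>k\<le>N. \<Sum>\<alpha> | length \<alpha> = k. a \<alpha>)"
  have A1: "1 \<le> A"
    by (simp add: A_def sum_nonneg a0)
  have "(\<Sum>\<alpha> | length \<alpha> = k. a \<alpha>) \<le> A * B ^ k" for k
  proof (cases "k \<le> N")
    case True
    have "(\<Sum>\<alpha> | length \<alpha> = k. a \<alpha>) \<le> (\<Sum>k\<le>N. \<Sum>\<alpha> | length \<alpha> = k. a \<alpha>)"
      by (rule member_le_sum) (use True in \<open>auto intro: sum_nonneg a0\<close>)
    also have "\<dots> \<le> A * 1"
      by (simp add: A_def)
    also have "\<dots> \<le> A * B ^ k"
      using A1 B1 by (intro mult_left_mono one_le_power) auto
    finally show ?thesis .
  next
    case False
    then have k: "k > 0" "k \<ge> N"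
      by auto
    have S0: "0 \<le> S k"
      by (simp add: S_def sum_nonneg)
    have "S k = root (2 * k) (S k) ^ (2 * k)"
      using k S0 by (simp add: real_root_pow_pos2)
    also have "\<dots> \<le> D ^ (2 * k)"
      using N[OF k(2)] S0 k(1) by (intro power_mono) (auto simp: D_def intro: real_root_pos_pos_le)
    finally have SD: "S k \<le> (D ^ k)\<^sup>2"
      by (simp add: power_mult[symmetric] mult.commute)
    have "a \<alpha> \<le> D ^ k" if "length \<alpha> = k" for \<alpha>
    proof -
      have "(a \<alpha>)\<^sup>2 \<le> S k"
        unfolding S_def using member_le_sum[of \<alpha> "{\<alpha>. length \<alpha> = k}" "\<lambda>\<alpha>. \<bar>a \<alpha>\<bar>\<^sup>2"] that
        by (simp add: finite_words)
      then show ?thesis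
        using SD D1 by (intro power2_le_imp_le[of "a \<alpha>"]) auto
    qed
    then have "(\<Sum>\<alpha> | length \<alpha> = k. a \<alpha>) \<le> of_nat (card {\<alpha> :: 'n list. length \<alpha> = k}) * D ^ k"
      by (intro sum_bounded_above) auto
    also have "\<dots> = 1 * B ^ k"
      by (simp add: card_words B_def power_mult_distrib)
    also have "\<dots> \<le> A * B ^ k"
      using A1 B1 by (intro mult_right_mono) auto
    finally show ?thesis .
  qed
  then show ?thesis
    using that[of A B] A1 B1 by simp
qed

text \<open>\<Phi> preserves selfadjointness. This makes the quadratic forms of the defects real,
  the first half of \<open>positive_op\<close>.\<close>

lemma adjoint_pair_is_Phi:
  assumes "\<And>i. adjointable (X $ i)" "is_Phi a id_blinfun X Y Z" "adjoint_pair Y Y"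
  shows "adjoint_pair Z Z"
proof -
  note adj = adjointable_adj_op[OF adjointable_op_word[of X, OF assms(1)]]
  have part: "cinner (Phi_part a X Y k x) y = cnj (cinner (Phi_part a X Y k y) x)" for k x y
  proof -
    have "cinner (op_word id_blinfun X \<alpha> (Y (adj_op (op_word id_blinfun X \<alpha>) x))) y =
        cnj (cinner (op_word id_blinfun X \<alpha> (Y (adj_op (op_word id_blinfun X \<alpha>) y))) x)" for \<alpha>
      by (simp only: adjoint_pairD[OF adj]) (subst adjoint_pairD[OF assms(3)], rule cinner_commute)
    then show ?thesis
      unfolding cinner_Phi_part cnj_sum complex_cnj_mult complex_cnj_complex_of_real by simp
  qed
  have "cinner (Z x) y = cinner x (Z y)" for x y
  proof -
    have "(\<lambda>k. cnj (cinner (Phi_part a X Y k y) x)) sums cnj (cinner (Z y) x)"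
      unfolding sums_cnj using assms(2) by (simp add: is_Phi_id)
    then have "(\<lambda>k. cinner (Phi_part a X Y k x) y) sums cnj (cinner (Z y) x)"
      by (simp only: part[of _ x y])
    moreover have "(\<lambda>k. cinner (Phi_part a X Y k x) y) sums cinner (Z x) y"
      using assms(2) by (simp add: is_Phi_id)
    ultimately have "cinner (Z x) y = cnj (cinner (Z y) x)"
      using sums_unique2 by blast
    then show ?thesis
      by (simp only: cinner_commute[of x "Z y"])
  qed
  then show ?thesis
    by (simp add: adjoint_pair_def)
qed

lemma norm_op_word_le:
  assumes "\<And>i. norm (X $ i) \<le> s" "0 \<le> s"
  shows "norm (op_word id_blinfun X \<alpha>) \<le> s ^ length \<alpha>"
proof (induction \<alpha>)
  case (Cons i \<alpha>)
  have "norm (op_word id_blinfun X (i # \<alpha>)) \<le> norm (X $ i) * norm (op_word id_blinfun X \<alpha>)"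
    by (simp add: norm_blinfun_compose)
  also have "\<dots> \<le> s * s ^ length \<alpha>"
    using assms Cons by (intro mult_mono) auto
  finally show ?case
    by simp
qed (simp add: norm_blinfun_id_le)

lemma norm_Phi_part_le:
  assumes "\<And>i. adjointable (X $ i)" "\<And>i. norm (X $ i) \<le> s" "0 \<le> s" "\<And>\<alpha>. 0 \<le> a \<alpha>"
  shows "norm (Phi_part a X Y k) \<le> (\<Sum>\<alpha> | length \<alpha> = Suc k. a \<alpha>) * (s\<^sup>2) ^ Suc k * norm Y"
proof -
  let ?W = "op_word id_blinfun X"
  have "norm (?W \<alpha> o\<^sub>L Y o\<^sub>L adj_op (?W \<alpha>)) \<le> (s\<^sup>2) ^ length \<alpha> * norm Y" for \<alpha>
  proof -
    have "norm (?W \<alpha> o\<^sub>L Y o\<^sub>L adj_op (?W \<alpha>)) \<le> norm (?W \<alpha>) * norm Y * norm (adj_op (?W \<alpha>))"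
      by (rule order_trans[OF norm_blinfun_compose]) (intro mult_right_mono norm_blinfun_compose norm_ge_zero)
    also have "\<dots> \<le> s ^ length \<alpha> * norm Y * s ^ length \<alpha>"
      using norm_op_word_le[of X s \<alpha>, OF assms(2,3)]
        adjoint_pair_norm_le[OF adjointable_adj_op[OF adjointable_op_word[of X \<alpha>, OF assms(1)]]]
        \<open>0 \<le> s\<close>
      by (intro mult_mono) auto
    finally show ?thesis
      by (simp add: power_mult[symmetric] power2_eq_square power_mult_distrib mult_ac)
  qed
  then have "norm (?W \<alpha> o\<^sub>L Y o\<^sub>L adj_op (?W \<alpha>)) \<le> (s\<^sup>2) ^ Suc k * norm Y" if "length \<alpha> = Suc k" for \<alpha>
    using that by metis
  then have "norm (Phi_part a X Y k) \<le> (\<Sum>\<alpha> | length \<alpha> = Suc k. a \<alpha> * ((s\<^sup>2) ^ Suc k * norm Y))"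
    unfolding Phi_part_def
    by (intro sum_norm_le) (auto simp: assms(4) mult_left_mono simp del: power_Suc)
  then show ?thesis
    by (simp only: sum_distrib_right mult.assoc)
qed

text \<open>For small tuples \<Phi> has norm at most \<delta>, so each of the first \<open>m\<close>
  defects stays within distance 1 of the identity. A selfadjoint operator that close to the identity
  is positive.\<close>

lemma nc_domain_near_zero:
  assumes a: "positive_regular a"
  obtains s where "s > 0"
    "\<And>X :: ('e::complex_hilbert \<Rightarrow>\<^sub>L 'e) ^ 'n::finite.
       (\<And>i. adjointable (X $ i)) \<Longrightarrow> (\<And>i. norm (X $ i) \<le> s) \<Longrightarrow> X \<in> nc_domain a m id_blinfun"
proof -
  obtain A B where AB: "A > 0" "B > 0" "\<And>k. (\<Sum>\<alpha> | length \<alpha> = k. a \<alpha>) \<le> A * B ^ k"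
    using positive_regular_bound[OF a] by blast
  have a0: "0 \<le> a \<alpha>" for \<alpha>
    using a by (simp add: positive_regular_def)
  \<comment> \<open>The distance of the \<open>k\<close>-th defect from the identity will be at most
    \<open>\<delta> * 2 ^ k\<close>, which has to be at most 1 for all
    \<open>k \<le> m\<close>.\<close>
  define \<delta> :: real where "\<delta> = 1 / 2 ^ m"
  have \<delta>: "0 < \<delta>" "\<delta> \<le> 1"
    by (auto simp: \<delta>_def)
  \<comment> \<open>\<open>q\<close> is the ratio \<open>B * s\<^sup>2\<close> of the majorizing
    geometric series. \<open>q \<le> 1/2\<close> bounds \<open>1 / (1 - q)\<close> by 2, and the
    second bound then makes the total at most \<delta>.\<close>
  define q where "q = min (1 / 2) (\<delta> / (2 * A))"
  have q: "0 < q" "q \<le> 1 / 2" "2 * A * q \<le> \<delta>"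
    using AB \<delta> by (auto simp: q_def min_def field_simps)
  define s where "s = sqrt (q / B)"
  have s: "0 < s" "B * s\<^sup>2 = q"
    using AB q by (auto simp: s_def)
  have "X \<in> nc_domain a m id_blinfun"
    if adj: "\<And>i. adjointable (X $ i)" and norm_X: "\<And>i. norm (X $ i) \<le> s"
    for X :: "('e \<Rightarrow>\<^sub>L 'e) ^ 'n"
  proof -
    have part: "norm (Phi_part a X Y k) \<le> A * q * norm Y * q ^ k" for Y k
    proof -
      have "norm (Phi_part a X Y k) \<le> (\<Sum>\<alpha> | length \<alpha> = Suc k. a \<alpha>) * (s\<^sup>2) ^ Suc k * norm Y"
        using s(1) by (intro norm_Phi_part_le adj norm_X a0) simp
      also have "\<dots> \<le> (A * B ^ Suc k) * (s\<^sup>2) ^ Suc k * norm Y"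
        by (intro mult_right_mono AB(3)) auto
      also have "\<dots> = A * (B * s\<^sup>2) ^ Suc k * norm Y"
        by (simp only: power_mult_distrib mult_ac)
      also have "\<dots> = A * q * norm Y * q ^ k"
        by (simp add: s(2))
      finally show ?thesis .
    qed
    have geo: "(\<lambda>k. A * q * norm Y * q ^ k) sums (A * q * norm Y * (1 / (1 - q)))" for Y :: "'e \<Rightarrow>\<^sub>L 'e"
      using q by (intro sums_mult geometric_sums) auto
    have norm_summable: "summable (\<lambda>k. norm (Phi_part a X Y k))" for Y
      by (rule summable_comparison_test'[OF sums_summable[OF geo[of Y]]]) (simp add: part)
    then have "Phi_part a X Y sums (\<Sum>k. Phi_part a X Y k)" for Y
      by (blast intro: summable_sums summable_norm_cancel)
    then have isPhi: "is_Phi a id_blinfun X Y (\<Sum>k. Phi_part a X Y k)" for Y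
      unfolding is_Phi_id
      using bounded_linear.sums[OF bounded_linear_compose[OF cinner.bounded_linear_left blinfun.bounded_linear_left]]
      by blast
    have norm_Phi: "norm (Phi a id_blinfun X Y) \<le> \<delta> * norm Y" for Y
    proof -
      have "norm (Phi a id_blinfun X Y) \<le> (\<Sum>k. norm (Phi_part a X Y k))"
        unfolding Phi_eq[OF isPhi] by (rule summable_norm[OF norm_summable])
      also have "\<dots> \<le> (\<Sum>k. A * q * norm Y * q ^ k)"
        by (intro suminf_le part norm_summable sums_summable[OF geo])
      also have "\<dots> = A * q * (1 / (1 - q)) * norm Y"
        by (simp add: sums_unique[OF geo, symmetric])
      also have "\<dots> \<le> A * q * 2 * norm Y"
        using q AB by (intro mult_right_mono mult_left_mono) (auto simp: field_simps)
      also have "\<dots> \<le> \<delta> * norm Y"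
        using q(3) by (intro mult_right_mono) (auto simp: mult_ac)
      finally show ?thesis .
    qed
    \<comment> \<open>The growth bound \<open>2 ^ k\<close> feeds the distance bound: step
      \<open>k\<close> changes the defect by at most \<open>\<delta> * 2 ^ k\<close>, which doubles
      the previous distance bound.\<close>
    have defect: "norm (defect a X k) \<le> 2 ^ k \<and> norm (defect a X k - id_blinfun) \<le> \<delta> * 2 ^ k \<and>
        adjoint_pair (defect a X k) (defect a X k)" for k
    proof (induction k)
      case 0
      then show ?case
        using \<delta> by (simp add: norm_blinfun_id_le adjoint_pair_id)
    next
      case (Suc k)
      let ?T = "defect a X k" and ?\<Phi> = "Phi a id_blinfun X (defect a X k)"
      have \<Phi>: "norm ?\<Phi> \<le> \<delta> * 2 ^ k"
        using order_trans[OF norm_Phi[of ?T]] Suc \<delta> by (meson mult_left_mono less_imp_le)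
      have "norm (?T - ?\<Phi>) \<le> norm ?T + norm ?\<Phi>"
        by (rule norm_triangle_ineq4)
      moreover have "\<delta> * 2 ^ k \<le> 2 ^ k"
        using \<delta> by simp
      ultimately have "norm (?T - ?\<Phi>) \<le> 2 ^ Suc k"
        using Suc \<Phi> unfolding power_Suc by linarith
      moreover have "norm (?T - ?\<Phi> - id_blinfun) \<le> norm (?T - id_blinfun) + norm ?\<Phi>"
        by (rule order_trans[OF _ norm_triangle_ineq4]) (simp add: algebra_simps)
      moreover have "adjoint_pair ?\<Phi> ?\<Phi>"
        using adjoint_pair_is_Phi[of X, OF adj isPhi] Suc by (simp add: Phi_eq[OF isPhi])
      ultimately show ?case
        using Suc \<Phi> adjoint_pair_diff by auto
    qed
    have "positive_op (defect a X k)" if k: "k \<in> {1..m}" for k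
      unfolding positive_op_def
    proof (intro allI conjI)
      fix x
      let ?T = "defect a X k"
      have "\<delta> * 2 ^ k \<le> \<delta> * 2 ^ m"
        using k \<delta> by (intro mult_left_mono power_increasing) auto
      also have "\<dots> = 1"
        by (simp add: \<delta>_def)
      finally have T1: "norm (?T - id_blinfun) \<le> 1"
        using defect[of k] by linarith
      have "cinner (?T x) x = cnj (cinner (?T x) x)"
        using adjoint_pairD[of ?T ?T x x] defect[of k] cinner_commute[of x "?T x"] by simp
      then show "Im (cinner (?T x) x) = 0"
        by (simp add: complex_eq_iff)
      have "cmod (cinner ((?T - id_blinfun) x) x) \<le> norm ((?T - id_blinfun) x) * norm x"
        by (rule cmod_cinner_le)
      also have "\<dots> \<le> (1 * norm x) * norm x"
        by (intro mult_right_mono order_trans[OF norm_blinfun] T1) auto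
      finally have "- (norm x)\<^sup>2 \<le> Re (cinner ((?T - id_blinfun) x) x)"
        using abs_Re_le_cmod[of "cinner ((?T - id_blinfun) x) x"] by (simp add: power2_eq_square)
      also have "\<dots> = Re (cinner (?T x) x) - (norm x)\<^sup>2"
        by (simp add: blinfun.diff_left cinner.diff_left cinner_self)
      finally show "0 \<le> Re (cinner (?T x) x)"
        by simp
    qed
    then show ?thesis
      unfolding nc_domain_id using isPhi adjoint_pair_clinear[OF adjointable_adj_op[OF adj]] by blast
  qed
  then show ?thesis
    using that s(1) by blast
qed

lemma zero_in_interior_matrix_domain:
  assumes "positive_regular a"
  shows "0 \<in> interior (matrix_domain a m :: (complex ^ 'p::finite ^ 'p ^ 'n::finite) set)"
proof -
  obtain s where s: "s > 0" "\<And>X :: ((complex ^ 'p) \<Rightarrow>\<^sub>L (complex ^ 'p)) ^ 'n.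
       (\<And>i. adjointable (X $ i)) \<Longrightarrow> (\<And>i. norm (X $ i) \<le> s) \<Longrightarrow> X \<in> nc_domain a m id_blinfun"
    using nc_domain_near_zero[OF assms] by blast
  define U where "U = (\<Inter>i. {\<Lambda> :: complex ^ 'p ^ 'p ^ 'n. norm (matrix_op (\<Lambda> $ i)) < s})"
  have "open U"
    unfolding U_def
    by (intro open_INT ballI open_Collect_less continuous_intros
        bounded_linear.continuous_on[OF bounded_linear_matrix_op]) auto
  moreover have "U \<subseteq> matrix_domain a m"
    by (auto simp: U_def matrix_domain_def less_imp_le adjointable_matrix_op intro!: s(2))
  moreover have "0 \<in> U"
    using s(1) by (simp add: U_def linear_0[OF bounded_linear.linear[OF bounded_linear_matrix_op]])
  ultimately show ?thesis
    by (meson interiorI)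
qed

section \<open>Holomorphy on the interior\<close>

lemma sv_holomorphic_on_const: "sv_holomorphic_on (\<lambda>x. c) S"
  unfolding sv_holomorphic_on_def by (intro ballI exI[of _ "\<lambda>_. 0"]) auto

lemma sv_holomorphic_on_mult:
  fixes f g :: "'a::complex_hilbert \<Rightarrow> complex"
  assumes "sv_holomorphic_on f S" "sv_holomorphic_on g S"
  shows "sv_holomorphic_on (\<lambda>x. f x * g x) S"
  unfolding sv_holomorphic_on_def
proof
  fix x
  assume "x \<in> S"
  then obtain D E where D: "(f has_derivative D) (at x)" "\<And>c v. D (c *\<^sub>C v) = c *\<^sub>C D v"
    and E: "(g has_derivative E) (at x)" "\<And>c v. E (c *\<^sub>C v) = c *\<^sub>C E v"
    using assms unfolding sv_holomorphic_on_def by meson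
  show "\<exists>D. ((\<lambda>x. f x * g x) has_derivative D) (at x) \<and> (\<forall>c v. D (c *\<^sub>C v) = c *\<^sub>C D v)"
    using has_derivative_mult[OF D(1) E(1)]
    by (intro exI conjI allI, assumption) (simp add: D(2) E(2) scaleC_complex_def algebra_simps)
qed

lemma sv_holomorphic_on_sum:
  fixes f :: "'i \<Rightarrow> 'a::complex_hilbert \<Rightarrow> 'b::complex_hilbert"
  assumes "\<And>i. i \<in> I \<Longrightarrow> sv_holomorphic_on (f i) S"
  shows "sv_holomorphic_on (\<lambda>x. \<Sum>i\<in>I. f i x) S"
  unfolding sv_holomorphic_on_def
proof
  fix x
  assume "x \<in> S"
  then have "\<forall>i\<in>I. \<exists>D. (f i has_derivative D) (at x) \<and> (\<forall>c v. D (c *\<^sub>C v) = c *\<^sub>C D v)"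
    using assms unfolding sv_holomorphic_on_def by blast
  then obtain D where D: "\<And>i. i \<in> I \<Longrightarrow> (f i has_derivative D i) (at x)"
    "\<And>i c v. i \<in> I \<Longrightarrow> D i (c *\<^sub>C v) = c *\<^sub>C D i v"
    by metis
  have "((\<lambda>x. \<Sum>i\<in>I. f i x) has_derivative (\<lambda>v. \<Sum>i\<in>I. D i v)) (at x)"
    by (intro has_derivative_sum D(1))
  moreover have "(\<Sum>i\<in>I. D i (c *\<^sub>C v)) = c *\<^sub>C (\<Sum>i\<in>I. D i v)" for c v
    by (simp add: D(2) linear_sum[OF bounded_linear.linear[OF bounded_linear_scaleC]])
  ultimately show "\<exists>D. ((\<lambda>x. \<Sum>i\<in>I. f i x) has_derivative D) (at x) \<and> (\<forall>c v. D (c *\<^sub>C v) = c *\<^sub>C D v)"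
    by blast
qed

lemma sv_holomorphic_on_vec:
  fixes f :: "'a::complex_hilbert \<Rightarrow> 'b::complex_hilbert ^ 'i::finite"
  assumes "\<And>i. sv_holomorphic_on (\<lambda>x. f x $ i) S"
  shows "sv_holomorphic_on f S"
  unfolding sv_holomorphic_on_def
proof
  fix x
  assume "x \<in> S"
  then have "\<forall>i. \<exists>D. ((\<lambda>x. f x $ i) has_derivative D) (at x) \<and> (\<forall>c v. D (c *\<^sub>C v) = c *\<^sub>C D v)"
    using assms unfolding sv_holomorphic_on_def by blast
  then obtain D where D: "\<And>i. ((\<lambda>x. f x $ i) has_derivative D i) (at x)"
    "\<And>i c v. D i (c *\<^sub>C v) = c *\<^sub>C D i v"
    by metis
  \<comment> \<open>Coordinate inclusions write \<open>f\<close> as a finite sum of bounded linear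
    images of its components.\<close>
  define \<iota> where "\<iota> = (\<lambda>(i :: 'i) (y :: 'b). \<chi> k. if k = i then y else 0)"
  have coord: "bounded_linear (\<lambda>y :: 'b. if k = i then y else 0)" for k i :: 'i
    by (cases "k = i") (simp_all add: bounded_linear_ident bounded_linear_zero)
  have \<iota>: "bounded_linear (\<iota> i)" for i
    unfolding \<iota>_def by (rule bounded_linear_vec_lambda) (rule coord)
  have expand: "(\<Sum>i\<in>UNIV. \<iota> i (v $ i)) = v" for v
    by (simp add: \<iota>_def vec_eq_iff)
  have "((\<lambda>x. \<Sum>i\<in>UNIV. \<iota> i (f x $ i)) has_derivative (\<lambda>v. \<Sum>i\<in>UNIV. \<iota> i (D i v))) (at x)"
    by (intro has_derivative_sum bounded_linear.has_derivative[OF \<iota>] D(1))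
  then have "(f has_derivative (\<lambda>v. \<chi> i. D i v)) (at x)"
    unfolding expand using expand[of "\<chi> i. D i _"] by simp
  then show "\<exists>D. (f has_derivative D) (at x) \<and> (\<forall>c v. D (c *\<^sub>C v) = c *\<^sub>C D v)"
    by (intro exI conjI allI, assumption) (simp add: D(2) scaleC_vec_def)
qed

lemma sv_holomorphic_on_matrix_entry:
  "sv_holomorphic_on (\<lambda>\<Lambda> :: complex ^ 'p::finite ^ 'p ^ 'n::finite. \<Lambda> $ i $ a $ b) S"
proof -
  have "bounded_linear (\<lambda>\<Lambda> :: complex ^ 'p ^ 'p ^ 'n. \<Lambda> $ i $ a $ b)"
    by (intro bounded_linear_compose[OF bounded_linear_vec_nth] bounded_linear_vec_nth)
  from bounded_linear_imp_has_derivative[OF this] show ?thesis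
    unfolding sv_holomorphic_on_def
    by (intro ballI exI[of _ "\<lambda>\<Lambda>. \<Lambda> $ i $ a $ b"]) (simp add: scaleC_vec_def)
qed

lemma sv_holomorphic_on_matrix_word:
  "sv_holomorphic_on (\<lambda>\<Lambda> :: complex ^ 'p::finite ^ 'p ^ 'n::finite. matrix_word \<Lambda> \<alpha> $ a $ b) S"
proof (induction \<alpha> arbitrary: a b)
  case Nil
  show ?case
    by (simp add: matrix_word_def sv_holomorphic_on_const)
next
  case (Cons i \<alpha>)
  have "matrix_word \<Lambda> (i # \<alpha>) $ a $ b = (\<Sum>k\<in>UNIV. \<Lambda> $ i $ a $ k * matrix_word \<Lambda> \<alpha> $ k $ b)"
    for \<Lambda> :: "complex ^ 'p ^ 'p ^ 'n"
    by (simp add: matrix_word_def matrix_matrix_mult_def)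
  then show ?case
    by (simp only:) (intro sv_holomorphic_on_sum sv_holomorphic_on_mult sv_holomorphic_on_matrix_entry Cons)
qed

lemma sv_holomorphic_on_matrix_part:
  "sv_holomorphic_on (\<lambda>\<Lambda> :: complex ^ 'p::finite ^ 'p ^ 'n::finite. matrix_part c \<Lambda> r k) S"
proof (intro sv_holomorphic_on_vec)
  fix a b
  have "matrix_part c \<Lambda> r k $ a $ b =
      (\<Sum>\<alpha> | length \<alpha> = k. (c \<alpha> * complex_of_real (r ^ length \<alpha>)) * matrix_word \<Lambda> \<alpha> $ a $ b)"
    for \<Lambda> :: "complex ^ 'p ^ 'p ^ 'n"
    by (simp add: matrix_part_def scaleC_vec_def scaleC_complex_def)
  then show "sv_holomorphic_on (\<lambda>\<Lambda> :: complex ^ 'p ^ 'p ^ 'n. matrix_part c \<Lambda> r k $ a $ b) S"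
    by (simp only:) (intro sv_holomorphic_on_sum sv_holomorphic_on_mult sv_holomorphic_on_const
        sv_holomorphic_on_matrix_word)
qed

section \<open>Cauchy estimates and locally uniform limits\<close>

text \<open>Restriction to the complex line through \<open>y\<close> in direction \<open>v\<close>,
  paired with a fixed vector, reduces the claim to Cauchy's inequality in one variable on the disc
  of radius \<open>\<rho> / norm v\<close>.\<close>

lemma Cauchy_derivative_bound:
  fixes f :: "'a::complex_hilbert \<Rightarrow> 'b::complex_hilbert"
  assumes f: "sv_holomorphic_on f (cball y \<rho>)" and "0 < \<rho>"
    and D: "(f has_derivative D) (at y)" "\<And>c v. D (c *\<^sub>C v) = c *\<^sub>C D v"
    and B: "\<And>x. x \<in> cball y \<rho> \<Longrightarrow> norm (f x) \<le> B"
  shows "norm (D v) \<le> B / \<rho> * norm v"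
proof (cases "v = 0 \<or> D v = 0")
  case True
  have "0 \<le> B"
    using \<open>0 < \<rho>\<close> by (intro order_trans[OF norm_ge_zero B[of y]]) simp
  then show ?thesis
    using True \<open>0 < \<rho>\<close> linear_0[OF has_derivative_linear[OF D(1)]] by auto
next
  case False
  \<comment> \<open>Pairing with \<open>D v\<close> itself makes the scalar derivative at 0 equal to
    the squared norm of \<open>D v\<close>.\<close>
  define w where "w = D v"
  define \<phi> where "\<phi> = (\<lambda>z. cinner (f (y + z *\<^sub>C v)) w)"
  define R where "R = \<rho> / norm v"
  have R: "0 < R"
    using False \<open>0 < \<rho>\<close> by (simp add: R_def)
  have mem: "y + z *\<^sub>C v \<in> cball y \<rho>" if "z \<in> cball 0 R" for z
    using that False by (simp add: dist_norm norm_scaleC R_def field_simps)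
  have deriv: "(\<phi> has_field_derivative cinner (E v) w) (at z)"
    if E: "(f has_derivative E) (at (y + z *\<^sub>C v))" "\<And>c v. E (c *\<^sub>C v) = c *\<^sub>C E v" for z E
  proof -
    have "bounded_linear (\<lambda>z. z *\<^sub>C v)"
      by (rule bounded_linear_intro[where K = "norm v"])
        (simp_all add: scaleC_add_left norm_scaleC scaleR_scaleC scaleC_scaleC scaleC_complex_def)
    from has_derivative_add[OF has_derivative_const[of y] bounded_linear_imp_has_derivative[OF this]]
    have "((\<lambda>z. y + z *\<^sub>C v) has_derivative (\<lambda>z. z *\<^sub>C v)) (at z)"
      by simp
    from has_derivative_compose[OF this E(1)]
    have "((\<lambda>z. f (y + z *\<^sub>C v)) has_derivative (\<lambda>h. E (h *\<^sub>C v))) (at z)" .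
    from bounded_linear.has_derivative[OF cinner.bounded_linear_left this]
    have "(\<phi> has_derivative (\<lambda>h. cinner (E (h *\<^sub>C v)) w)) (at z)"
      unfolding \<phi>_def .
    then show ?thesis
      by (simp add: has_field_derivative_def E(2) cinner_scaleC_left mult_commute_abs)
  qed
  have diff: "\<phi> field_differentiable at z" if "z \<in> cball 0 R" for z
    using f mem[OF that] deriv unfolding sv_holomorphic_on_def field_differentiable_def by meson
  have "\<phi> holomorphic_on ball 0 R"
    unfolding holomorphic_on_def using diff by (auto intro: field_differentiable_at_within)
  moreover have "continuous_on (cball 0 R) \<phi>"
    using diff by (intro continuous_at_imp_continuous_on ballI field_differentiable_imp_continuous_at) auto
  moreover have "norm (\<phi> z) \<le> B * norm w" if "norm (0 - z) = R" for z
  proof -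
    have "norm (\<phi> z) \<le> norm (f (y + z *\<^sub>C v)) * norm w"
      unfolding \<phi>_def by (rule cmod_cinner_le)
    also have "\<dots> \<le> B * norm w"
      using that by (intro mult_right_mono B mem) auto
    finally show ?thesis .
  qed
  ultimately have "norm ((deriv ^^ 1) \<phi> 0) \<le> fact 1 * (B * norm w) / R ^ 1"
    by (intro Cauchy_inequality R)
  moreover have "deriv \<phi> 0 = cinner w w"
    using DERIV_imp_deriv[OF deriv[of D 0]] D by (simp add: w_def)
  ultimately have "(norm w)\<^sup>2 \<le> B * norm w / R"
    by (simp add: cinner_self norm_power)
  then have "norm w * norm w \<le> (B / \<rho> * norm v) * norm w"
    by (simp add: R_def power2_eq_square mult_ac)
  then have "norm w \<le> B / \<rho> * norm v"
    by (rule mult_right_le_imp_le) (use False in \<open>simp add: w_def\<close>)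
  then show ?thesis
    by (simp add: w_def)
qed

lemma sv_holomorphic_on_diff:
  assumes "sv_holomorphic_on f S" "sv_holomorphic_on g S"
  shows "sv_holomorphic_on (\<lambda>x. f x - g x) S"
  unfolding sv_holomorphic_on_def
proof
  fix x
  assume "x \<in> S"
  then obtain D E where D: "(f has_derivative D) (at x)" "\<And>c v. D (c *\<^sub>C v) = c *\<^sub>C D v"
    and E: "(g has_derivative E) (at x)" "\<And>c v. E (c *\<^sub>C v) = c *\<^sub>C E v"
    using assms unfolding sv_holomorphic_on_def by meson
  show "\<exists>D. ((\<lambda>x. f x - g x) has_derivative D) (at x) \<and> (\<forall>c v. D (c *\<^sub>C v) = c *\<^sub>C D v)"
    using has_derivative_diff[OF D(1) E(1)]
    by (intro exI conjI allI, assumption)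
      (simp add: D(2) E(2) linear_diff[OF bounded_linear.linear[OF bounded_linear_scaleC]])
qed

lemma sv_holomorphic_on_subset: "sv_holomorphic_on f S \<Longrightarrow> T \<subseteq> S \<Longrightarrow> sv_holomorphic_on f T"
  by (auto simp: sv_holomorphic_on_def)

text \<open>Weierstrass' theorem: the Cauchy bound turns uniform convergence of the functions into
  uniform convergence of the derivatives on a smaller ball, where limit and derivative can be
  exchanged.\<close>

lemma sv_holomorphic_on_locally_uniform_limit:
  fixes f :: "nat \<Rightarrow> 'a::complex_hilbert \<Rightarrow> 'b::complex_hilbert"
  assumes f: "\<And>n. sv_holomorphic_on (f n) S"
    and lim: "\<And>x. x \<in> S \<Longrightarrow> \<exists>R>0. cball x R \<subseteq> S \<and> uniform_limit (cball x R) f g sequentially"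
  shows "sv_holomorphic_on g S"
  unfolding sv_holomorphic_on_def
proof
  fix x0
  assume "x0 \<in> S"
  then obtain R where R: "R > 0" "cball x0 R \<subseteq> S" "uniform_limit (cball x0 R) f g sequentially"
    using lim by blast
  \<comment> \<open>Half the radius leaves a ball of radius \<open>R / 2\<close> around each point
    of \<open>T\<close> for the Cauchy bound.\<close>
  define T where "T = ball x0 (R / 2)"
  have cball_T: "cball x (R / 2) \<subseteq> cball x0 R" if "x \<in> T" for x
  proof
    fix y
    assume "y \<in> cball x (R / 2)"
    then show "y \<in> cball x0 R"
      using that dist_triangle[of x0 y x] by (simp add: T_def)
  qed
  have "\<forall>n. \<forall>x\<in>S. \<exists>D. (f n has_derivative D) (at x) \<and> (\<forall>c v. D (c *\<^sub>C v) = c *\<^sub>C D v)"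
    using f by (simp add: sv_holomorphic_on_def)
  then obtain D where D: "\<And>n x. x \<in> S \<Longrightarrow> (f n has_derivative D n x) (at x)"
    "\<And>n x c v. x \<in> S \<Longrightarrow> D n x (c *\<^sub>C v) = c *\<^sub>C D n x v"
    by metis
  have TS: "T \<subseteq> S"
    using R(1,2) unfolding T_def by (force simp: subset_iff)
  have cauchy: "\<exists>N. \<forall>m\<ge>N. \<forall>n\<ge>N. \<forall>x\<in>T. \<forall>h. norm (D m x h - D n x h) \<le> e * norm h" if "e > 0" for e
  proof -
    \<comment> \<open>Two errors of \<open>e * R / 4\<close> bound the difference by
      \<open>e * R / 2\<close>, and dividing by the radius \<open>R / 2\<close> leaves
      \<open>e\<close>.\<close>
    have "0 < e * R / 4"
      using that R(1) by simp
    then obtain N where N: "\<And>n x. n \<ge> N \<Longrightarrow> x \<in> cball x0 R \<Longrightarrow> dist (f n x) (g x) < e * R / 4"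
      using R(3) unfolding uniform_limit_sequentially_iff by meson
    have "norm (D m x h - D n x h) \<le> e * norm h" if mn: "m \<ge> N" "n \<ge> N" and x: "x \<in> T" for m n x h
    proof -
      have "norm (D m x h - D n x h) \<le> (e * R / 2) / (R / 2) * norm h"
      proof (rule Cauchy_derivative_bound)
        show "sv_holomorphic_on (\<lambda>x. f m x - f n x) (cball x (R / 2))"
          by (rule sv_holomorphic_on_subset[OF sv_holomorphic_on_diff[OF f f]])
            (use cball_T[OF x] R(2) in blast)
        show "((\<lambda>x. f m x - f n x) has_derivative (\<lambda>h. D m x h - D n x h)) (at x)"
          using x TS by (intro has_derivative_diff D) auto
        show "D m x (c *\<^sub>C v) - D n x (c *\<^sub>C v) = c *\<^sub>C (D m x v - D n x v)" for c v
          using x TS by (simp add: D subset_iff linear_diff[OF bounded_linear.linear[OF bounded_linear_scaleC]])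
        fix y
        assume "y \<in> cball x (R / 2)"
        then have "y \<in> cball x0 R"
          using cball_T[OF x] by blast
        then show "norm (f m y - f n y) \<le> e * R / 2"
          using N[OF mn(1), of y] N[OF mn(2), of y] dist_triangle2[of "f m y" "f n y" "g y"]
          by (simp add: dist_norm)
      qed (use R(1) in simp)
      then show ?thesis
        using R(1) by simp
    qed
    then show ?thesis
      by blast
  qed
  define D' where "D' = (\<lambda>x h. lim (\<lambda>n. D n x h))"
  have D': "(\<lambda>n. D n x h) \<longlonglongrightarrow> D' x h" if x: "x \<in> T" for x h
  proof -
    have "Cauchy (\<lambda>n. D n x h)"
    proof (rule CauchyI)
      fix e :: real
      assume "e > 0"
      then have "e / (norm h + 1) > 0"
        by (simp add: add_nonneg_pos)
      then obtain N where N: "\<forall>m\<ge>N. \<forall>n\<ge>N. \<forall>x\<in>T. \<forall>h'. norm (D m x h' - D n x h') \<le> e / (norm h + 1) * norm h'"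
        using cauchy by blast
      have "e / (norm h + 1) * norm h < e"
        using \<open>e > 0\<close> by (simp add: pos_divide_less_eq add_nonneg_pos)
      then show "\<exists>M. \<forall>m\<ge>M. \<forall>n\<ge>M. norm (D m x h - D n x h) < e"
        using N x by (meson le_less_trans)
    qed
    then show ?thesis
      unfolding D'_def by (simp add: Cauchy_convergent convergent_LIMSEQ_iff[symmetric])
  qed
  have x0T: "x0 \<in> T"
    using R(1) by (simp add: T_def)
  have pointwise: "(\<lambda>n. f n x) \<longlonglongrightarrow> g x" if "x \<in> T" for x
  proof (rule tendsto_uniform_limitI[OF R(3)])
    show "x \<in> cball x0 R"
      using R(1) by (intro subsetD[OF cball_T[OF that]]) simp
  qed
  \<comment> \<open>The exchange theorem yields its own limit function \<open>g2\<close>, identified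
    with \<open>g\<close> on \<open>T\<close> afterwards by pointwise convergence.\<close>
  have "\<exists>g2. \<forall>x\<in>T. (\<lambda>n. f n x) \<longlonglongrightarrow> g2 x \<and> (g2 has_derivative D' x) (at x within T)"
  proof (rule has_derivative_sequence)
    show "convex T"
      by (simp add: T_def)
    show "(f n has_derivative D n x) (at x within T)" if "x \<in> T" for n x
      using that TS by (auto intro: has_derivative_at_withinI[OF D(1)])
    show "x0 \<in> T"
      by (rule x0T)
    show "(\<lambda>n. f n x0) \<longlonglongrightarrow> g x0"
      by (rule pointwise[OF x0T])
    fix e :: real
    assume "e > 0"
    then obtain N where N: "\<forall>m\<ge>N. \<forall>n\<ge>N. \<forall>x\<in>T. \<forall>h. norm (D m x h - D n x h) \<le> e * norm h"
      using cauchy by blast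
    have "norm (D n x h - D' x h) \<le> e * norm h" if "n \<ge> N" "x \<in> T" for n x h
    proof (rule LIMSEQ_le_const2)
      show "(\<lambda>m. norm (D n x h - D m x h)) \<longlonglongrightarrow> norm (D n x h - D' x h)"
        by (intro tendsto_intros D' that)
    qed (use N that in blast)
    then show "\<forall>\<^sub>F n in sequentially. \<forall>x\<in>T. \<forall>h. norm (D n x h - D' x h) \<le> e * norm h"
      unfolding eventually_sequentially by blast
  qed
  then obtain g2 where g2: "\<And>x. x \<in> T \<Longrightarrow> (\<lambda>n. f n x) \<longlonglongrightarrow> g2 x"
    "\<And>x. x \<in> T \<Longrightarrow> (g2 has_derivative D' x) (at x within T)"
    by blast
  have "(g2 has_derivative D' x0) (at x0)"
    using g2(2)[OF x0T] x0T at_within_open[of x0 T] by (simp add: T_def)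
  then have "(g has_derivative D' x0) (at x0)"
    by (rule has_derivative_transform_within_open[of _ _ _ _ T])
      (use x0T LIMSEQ_unique[OF g2(1) pointwise] in \<open>auto simp: T_def\<close>)
  moreover have "D' x0 (c *\<^sub>C v) = c *\<^sub>C D' x0 v" for c v
  proof (rule LIMSEQ_unique[OF D'[OF x0T]])
    show "(\<lambda>n. D n x0 (c *\<^sub>C v)) \<longlonglongrightarrow> c *\<^sub>C D' x0 v"
      using \<open>x0 \<in> S\<close> by (simp add: D(2) bounded_linear.tendsto[OF bounded_linear_scaleC D'[OF x0T]])
  qed
  ultimately show "\<exists>D. (g has_derivative D) (at x0) \<and> (\<forall>c v. D (c *\<^sub>C v) = c *\<^sub>C D v)"
    by blast
qed

text \<open>Cauchy's inequality on the circle of radius \<rho> gives the bound up to the factor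
  \<open>\<rho> ^ k\<close>. The unit circle lies outside the hypotheses, so \<rho> tends to 1 at
  the end.\<close>

lemma power_series_coefficient_bound:
  assumes sums: "\<And>z. cmod z < 1 \<Longrightarrow> (\<lambda>k. b k * z ^ k) sums \<phi> z"
    and B: "\<And>z. cmod z < 1 \<Longrightarrow> cmod (\<phi> z) \<le> B"
  shows "cmod (b k) \<le> B"
proof -
  have hol: "\<phi> holomorphic_on ball 0 1"
    by (rule power_series_holomorphic[of 0 1 b]) (simp add: sums)
  \<comment> \<open>The formal power series serves to identify the derivatives of
    \<open>\<phi>\<close> at 0 with \<open>fact k * b k\<close>.\<close>
  define F where "F = Abs_fps b"
  have "fps_conv_radius F \<ge> 1"
    unfolding fps_conv_radius_def
  proof (rule conv_radius_geI_ex)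
    fix r :: real
    assume "0 < r" "ereal r < 1"
    then show "\<exists>z. norm z = r \<and> summable (\<lambda>n. fps_nth F n * z ^ n)"
      using sums[of "of_real r"] by (intro exI[of _ "of_real r"]) (auto simp: F_def sums_summable)
  qed
  moreover have "\<forall>\<^sub>F z in nhds 0. eval_fps F z = \<phi> z"
  proof (rule eventually_mono[OF eventually_nhds_in_open[of "ball 0 1"]])
    show "eval_fps F z = \<phi> z" if "z \<in> ball 0 1" for z
      using sums[of z] that by (simp add: eval_fps_def F_def sums_unique[symmetric])
  qed auto
  ultimately have "\<phi> has_fps_expansion F"
    unfolding has_fps_expansion_def by (auto intro: less_le_trans[of 0 1])
  from fps_nth_fps_expansion[OF this, of k] have coeff: "(deriv ^^ k) \<phi> 0 = fact k * b k"
    by (simp add: F_def)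
  have "cmod (b k) * \<rho> ^ k \<le> B" if \<rho>: "0 < \<rho>" "\<rho> < 1" for \<rho>
  proof -
    have "cmod ((deriv ^^ k) \<phi> 0) \<le> fact k * B / \<rho> ^ k"
    proof (rule Cauchy_inequality)
      show "\<phi> holomorphic_on ball 0 \<rho>"
        by (rule holomorphic_on_subset[OF hol]) (use \<rho> in auto)
      show "continuous_on (cball 0 \<rho>) \<phi>"
        by (rule holomorphic_on_imp_continuous_on[OF holomorphic_on_subset[OF hol]]) (use \<rho> in auto)
    qed (use \<rho> B in auto)
    then show ?thesis
      using \<rho> by (simp add: coeff norm_mult field_simps)
  qed
  then have "\<forall>\<^sub>F \<rho> in at_left (1::real). cmod (b k) * \<rho> ^ k \<le> B"
    by (intro eventually_at_leftI[of 0]) auto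
  moreover have "((\<lambda>\<rho>. cmod (b k) * \<rho> ^ k) \<longlongrightarrow> cmod (b k) * 1 ^ k) (at_left (1::real))"
    by (intro tendsto_intros)
  ultimately show ?thesis
    using tendsto_upperbound[of _ "cmod (b k) * 1 ^ k" "at_left (1::real)"] by simp
qed

lemma bounded_bilinear_scaleC: "bounded_bilinear (\<lambda>z (x :: 'a::complex_hilbert). z *\<^sub>C x)"
proof
  fix z z' :: complex and x x' :: 'a and r :: real
  show "(z + z') *\<^sub>C x = z *\<^sub>C x + z' *\<^sub>C x" "z *\<^sub>C (x + x') = z *\<^sub>C x + z *\<^sub>C x'"
    by (rule scaleC_add_left scaleC_add_right)+
  show "(r *\<^sub>R z) *\<^sub>C x = r *\<^sub>R z *\<^sub>C x"
    by (simp only: scaleR_scaleC[of r "z *\<^sub>C x"] scaleC_scaleC scaleR_conv_of_real)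
  show "z *\<^sub>C (r *\<^sub>R x) = r *\<^sub>R z *\<^sub>C x"
    by (simp only: scaleR_scaleC scaleC_scaleC mult.commute)
  show "\<exists>K. \<forall>z (x :: 'a). norm (z *\<^sub>C x) \<le> norm z * norm x * K"
    by (intro exI[of _ 1]) (simp add: norm_scaleC)
qed

lemma matrix_part_scaleC: "matrix_part c (z *\<^sub>C \<Lambda>) r k = z ^ k *\<^sub>C matrix_part c \<Lambda> r k"
proof -
  have "matrix_word (z *\<^sub>C \<Lambda>) \<alpha> = z ^ length \<alpha> *\<^sub>C matrix_word \<Lambda> \<alpha>" for \<alpha>
    by (induction \<alpha>)
      (simp_all add: matrix_word_def matrix_matrix_mult_def vec_eq_iff scaleC_vec_def
        scaleC_complex_def sum_distrib_left mult_ac)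
  then show ?thesis
    by (simp add: matrix_part_def scaleC_scaleC mult.commute
        linear_sum[OF bounded_linear.linear[OF bounded_linear_scaleC]])
qed

lemma matrix_part_radius: "matrix_part c \<Lambda> r k = r ^ k *\<^sub>R matrix_part c \<Lambda> 1 k"
  by (simp add: matrix_part_def scaleR_scaleC scaleC_scaleC mult.commute
      linear_sum[OF bounded_linear.linear[OF bounded_linear_scaleC]])

text \<open>Along the disc \<open>z *\<^sub>C \<Lambda>\<close> the homogeneous part of degree
  \<open>k\<close> is the \<open>k\<close>-th Taylor coefficient of \<open>f\<close>. Pairing with
  that part itself reduces the bound to scalar power series.\<close>

lemma norm_matrix_part_le:
  fixes \<Lambda> :: "complex ^ 'p::finite ^ 'p ^ 'n::finite"
  assumes sums: "\<And>u r. cmod u = 1 \<Longrightarrow> r \<in> {0..<1} \<Longrightarrow>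
      matrix_part c (u *\<^sub>C \<Lambda>) r sums f (r *\<^sub>R u *\<^sub>C \<Lambda>)"
    and B: "\<And>z. cmod z \<le> 1 \<Longrightarrow> norm (f (z *\<^sub>C \<Lambda>)) \<le> B"
  shows "norm (matrix_part c \<Lambda> 1 k) \<le> B"
proof -
  define w where "w = matrix_part c \<Lambda> 1 k"
  have "(\<lambda>k. cinner (matrix_part c \<Lambda> 1 k) w * z ^ k) sums cinner (f (z *\<^sub>C \<Lambda>)) w" if "cmod z < 1" for z
  proof -
    \<comment> \<open>The series is given only for phases and radii separately, so \<open>z\<close>
      is split into both.\<close>
    define u where "u = (if z = 0 then 1 else sgn z)"
    have u: "cmod u = 1"
      by (simp add: u_def norm_sgn)
    define t where "t = cmod z"
    have z: "complex_of_real t * u = z"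
      by (simp add: u_def t_def sgn_eq)
    have "z ^ k = complex_of_real (t ^ k) * u ^ k" for k
      unfolding z[symmetric] by (simp add: power_mult_distrib)
    then have part: "matrix_part c (u *\<^sub>C \<Lambda>) t k = z ^ k *\<^sub>C matrix_part c \<Lambda> 1 k" for k
      by (simp only: matrix_part_radius[of c \<Lambda> t] matrix_part_scaleC scaleR_scaleC scaleC_scaleC mult.commute)
    have "t *\<^sub>R u *\<^sub>C \<Lambda> = z *\<^sub>C \<Lambda>"
      by (simp only: scaleR_scaleC scaleC_scaleC z)
    moreover have "matrix_part c (u *\<^sub>C \<Lambda>) t sums f (t *\<^sub>R u *\<^sub>C \<Lambda>)"
      using that by (intro sums u) (simp add: t_def)
    ultimately have "(\<lambda>k. z ^ k *\<^sub>C matrix_part c \<Lambda> 1 k) sums f (z *\<^sub>C \<Lambda>)"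
      by (simp add: part[THEN ext])
    from bounded_linear.sums[OF cinner.bounded_linear_left this, of w] show ?thesis
      by (simp add: cinner_scaleC_left mult.commute)
  qed
  moreover have "cmod (cinner (f (z *\<^sub>C \<Lambda>)) w) \<le> B * norm w" if "cmod z < 1" for z
    using that by (intro order_trans[OF cmod_cinner_le] mult_right_mono B) auto
  ultimately have "cmod (cinner w w) \<le> B * norm w"
    unfolding w_def by (rule power_series_coefficient_bound)
  moreover have "0 \<le> B"
    using order_trans[OF norm_ge_zero B[of 0]] by simp
  ultimately show ?thesis
    by (cases "w = 0") (simp_all add: cinner_self norm_mult power2_eq_square w_def)
qed

text \<open>The domain is circular, so the homogeneous parts obey Cauchy estimates and the series converges
  uniformly on compact sets at each radius \<open>r < 1\<close>; uniform continuity then allows \<open>r \<rightarrow> 1\<close>.\<close>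

lemma sv_holomorphic_on_matrix_map:
  fixes a :: "'n::finite list \<Rightarrow> real" and m :: nat
    and c :: "'q::finite \<Rightarrow> 'n list \<Rightarrow> complex"
  defines "D \<equiv> matrix_domain a m :: (complex ^ 'p::finite ^ 'p ^ 'n) set"
  assumes star: "starlike_at_0 D"
    and cont: "continuous_on D (matrix_map c)"
    and sums: "\<And>\<Lambda> r j. \<Lambda> \<in> D \<Longrightarrow> r \<in> {0..<1} \<Longrightarrow> matrix_part (c j) \<Lambda> r sums (matrix_map c (r *\<^sub>R \<Lambda>) $ j)"
  shows "sv_holomorphic_on (matrix_map c) (interior D)"
proof -
  have disc: "z *\<^sub>C \<Lambda> \<in> D" if "\<Lambda> \<in> D" "cmod z \<le> 1" for z \<Lambda>
    using matrix_domain_disc[of a m \<Lambda> z] star that by (simp add: D_def)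
  have local_bound: "\<exists>R>0. cball x R \<subseteq> interior D \<and> compact ((\<lambda>(z, \<Lambda>). z *\<^sub>C \<Lambda>) ` (cball 0 1 \<times> cball x R)) \<and>
      (\<lambda>(z, \<Lambda>). z *\<^sub>C \<Lambda>) ` (cball 0 1 \<times> cball x R) \<subseteq> D"
    if x: "x \<in> interior D" for x
  proof -
    obtain R where R: "R > 0" "cball x R \<subseteq> interior D"
      using open_contains_cball[THEN iffD1, OF open_interior, rule_format, OF x] by blast
    \<comment> \<open>The union of all discs through the closed ball is compact because scaling is
      jointly continuous; \<open>disc\<close> keeps it inside the domain.\<close>
    have "compact ((\<lambda>(z, \<Lambda>). z *\<^sub>C \<Lambda>) ` (cball (0::complex) 1 \<times> cball x R))"
      unfolding case_prod_unfold
      by (intro compact_continuous_image compact_Times compact_cball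
          bounded_bilinear.continuous_on[OF bounded_bilinear_scaleC] continuous_intros)
    moreover have "(\<lambda>(z, \<Lambda>). z *\<^sub>C \<Lambda>) ` (cball 0 1 \<times> cball x R) \<subseteq> D"
      using R(2) interior_subset[of D] by (auto intro!: disc)
    ultimately show ?thesis
      using R by blast
  qed
  have radial: "sv_holomorphic_on (\<lambda>\<Lambda>. matrix_map c (r *\<^sub>R \<Lambda>) $ j) (interior D)"
    if r: "r \<in> {0..<1}" for r j
  proof (rule sv_holomorphic_on_locally_uniform_limit[of "\<lambda>n \<Lambda>. \<Sum>k<n. matrix_part (c j) \<Lambda> r k"])
    show "sv_holomorphic_on (\<lambda>\<Lambda>. \<Sum>k<n. matrix_part (c j) \<Lambda> r k) (interior D)" for n
      by (intro sv_holomorphic_on_sum sv_holomorphic_on_matrix_part)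
    fix x
    assume "x \<in> interior D"
    then obtain R where R: "R > 0" "cball x R \<subseteq> interior D"
      "compact ((\<lambda>(z, \<Lambda>). z *\<^sub>C \<Lambda>) ` (cball 0 1 \<times> cball x R))"
      "(\<lambda>(z, \<Lambda>). z *\<^sub>C \<Lambda>) ` (cball 0 1 \<times> cball x R) \<subseteq> D"
      using local_bound by blast
    have "bounded ((\<lambda>\<Lambda>. matrix_map c \<Lambda> $ j) ` (\<lambda>(z, \<Lambda>). z *\<^sub>C \<Lambda>) ` (cball 0 1 \<times> cball x R))"
      by (rule compact_imp_bounded, rule compact_continuous_image, rule continuous_on_component,
          rule continuous_on_subset[OF cont], rule R(4), rule R(3))
    then obtain B where B: "\<And>z \<Lambda>. cmod z \<le> 1 \<Longrightarrow> \<Lambda> \<in> cball x R \<Longrightarrow> norm (matrix_map c (z *\<^sub>C \<Lambda>) $ j) \<le> B"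
      unfolding bounded_iff by (force simp: image_iff)
    have xD: "\<Lambda> \<in> D" if "\<Lambda> \<in> cball x R" for \<Lambda>
      using that R(2) interior_subset by blast
    \<comment> \<open>At radius 1 only the single homogeneous polynomials are estimated; convergence
      of their sum at that radius is not claimed.\<close>
    have part: "norm (matrix_part (c j) \<Lambda> 1 k) \<le> B" if \<Lambda>: "\<Lambda> \<in> cball x R" for \<Lambda> k
    proof (rule norm_matrix_part_le[where f = "\<lambda>\<Lambda>. matrix_map c \<Lambda> $ j"])
      show "matrix_part (c j) (u *\<^sub>C \<Lambda>) r sums (matrix_map c (r *\<^sub>R u *\<^sub>C \<Lambda>) $ j)"
        if "cmod u = 1" "r \<in> {0..<1}" for u r
        by (rule sums[OF disc[OF xD[OF \<Lambda>]]]) (use that in auto)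
    qed (rule B[OF _ \<Lambda>])
    have "uniform_limit (cball x R) (\<lambda>n \<Lambda>. \<Sum>k<n. matrix_part (c j) \<Lambda> r k)
        (\<lambda>\<Lambda>. \<Sum>k. matrix_part (c j) \<Lambda> r k) sequentially"
    \<comment> \<open>The bound \<open>B\<close> is uniform in the matrix tuple and in the degree,
      and \<open>r < 1\<close> makes the majorant geometric.\<close>
    proof (rule Weierstrass_m_test)
      show "norm (matrix_part (c j) \<Lambda> r k) \<le> B * r ^ k" if "\<Lambda> \<in> cball x R" for k \<Lambda>
      proof -
        have "r ^ k * norm (matrix_part (c j) \<Lambda> 1 k) \<le> r ^ k * B"
          using r by (intro mult_left_mono part that) simp
        then show ?thesis
          using r by (simp add: matrix_part_radius[of _ _ r] mult.commute)
      qed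
      show "summable (\<lambda>k. B * r ^ k)"
        using r by (intro summable_mult summable_geometric) auto
    qed
    then have "uniform_limit (cball x R) (\<lambda>n \<Lambda>. \<Sum>k<n. matrix_part (c j) \<Lambda> r k)
        (\<lambda>\<Lambda>. matrix_map c (r *\<^sub>R \<Lambda>) $ j) sequentially"
      by (rule uniform_limit_cong'[THEN iffD1, rotated 2]) (use sums_unique[OF sums[OF xD r]] in auto)
    then show "\<exists>R>0. cball x R \<subseteq> interior D \<and> uniform_limit (cball x R)
        (\<lambda>n \<Lambda>. \<Sum>k<n. matrix_part (c j) \<Lambda> r k) (\<lambda>\<Lambda>. matrix_map c (r *\<^sub>R \<Lambda>) $ j) sequentially"
      using R by blast
  qed
  define \<rho> where "\<rho> = (\<lambda>n. 1 - inverse (real (Suc n)))"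
  have \<rho>: "\<rho> n \<in> {0..<1}" for n
    by (simp add: \<rho>_def divide_simps)
  have \<rho>_lim: "\<rho> \<longlonglongrightarrow> 1"
    unfolding \<rho>_def using tendsto_diff[OF tendsto_const LIMSEQ_inverse_real_of_nat] by simp
  show ?thesis
  proof (rule sv_holomorphic_on_locally_uniform_limit[of "\<lambda>n \<Lambda>. matrix_map c (\<rho> n *\<^sub>R \<Lambda>)"])
    show "sv_holomorphic_on (\<lambda>\<Lambda>. matrix_map c (\<rho> n *\<^sub>R \<Lambda>)) (interior D)" for n
      by (intro sv_holomorphic_on_vec radial \<rho>)
    fix x
    assume "x \<in> interior D"
    then obtain R where R: "R > 0" "cball x R \<subseteq> interior D"
      "compact ((\<lambda>(z, \<Lambda>). z *\<^sub>C \<Lambda>) ` (cball 0 1 \<times> cball x R))" (is "compact ?C")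
      "(\<lambda>(z, \<Lambda>). z *\<^sub>C \<Lambda>) ` (cball 0 1 \<times> cball x R) \<subseteq> D"
      using local_bound by blast
    have C: "r *\<^sub>R \<Lambda> \<in> ?C" if "r \<in> {0..1}" "\<Lambda> \<in> cball x R" for r \<Lambda>
      using that by (auto simp: scaleR_scaleC intro!: image_eqI[of _ _ "(complex_of_real r, \<Lambda>)"])
    \<comment> \<open>Both \<open>\<Lambda>\<close> and \<open>\<rho> n *\<^sub>R \<Lambda>\<close>
      lie in this compact set, so their distance, at most
      \<open>\<bar>\<rho> n - 1\<bar> * (norm x + R)\<close>, controls the values uniformly.\<close>
    have uc: "uniformly_continuous_on ?C (matrix_map c)"
      using R(3,4) by (intro compact_uniformly_continuous continuous_on_subset[OF cont])
    have "uniform_limit (cball x R) (\<lambda>n \<Lambda>. matrix_map c (\<rho> n *\<^sub>R \<Lambda>)) (matrix_map c) sequentially"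
      unfolding uniform_limit_iff
    proof (intro allI impI)
      fix e :: real
      assume "e > 0"
      obtain d where d: "d > 0"
        "\<And>x y. x \<in> ?C \<Longrightarrow> y \<in> ?C \<Longrightarrow> dist y x < d \<Longrightarrow> dist (matrix_map c y) (matrix_map c x) < e"
        by (rule uniformly_continuous_onE[OF uc \<open>e > 0\<close>]) (rule that)
      have "(\<lambda>n. \<bar>\<rho> n - 1\<bar> * (norm x + R)) \<longlonglongrightarrow> \<bar>1 - 1\<bar> * (norm x + R)"
        by (intro tendsto_intros \<rho>_lim)
      then have "\<forall>\<^sub>F n in sequentially. \<bar>\<rho> n - 1\<bar> * (norm x + R) < d"
        using d(1) by (intro order_tendstoD(2)) auto
      then show "\<forall>\<^sub>F n in sequentially. \<forall>\<Lambda>\<in>cball x R. dist (matrix_map c (\<rho> n *\<^sub>R \<Lambda>)) (matrix_map c \<Lambda>) < e"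
      proof eventually_elim
        case (elim n)
        show ?case
        proof
          fix \<Lambda>
          assume \<Lambda>: "\<Lambda> \<in> cball x R"
          then have "norm \<Lambda> \<le> norm x + R"
            using norm_triangle_sub[of \<Lambda> x] by (simp add: dist_norm norm_minus_commute)
          have "\<rho> n *\<^sub>R \<Lambda> - \<Lambda> = (\<rho> n - 1) *\<^sub>R \<Lambda>"
            by (simp add: algebra_simps)
          then have "dist (\<rho> n *\<^sub>R \<Lambda>) \<Lambda> = \<bar>\<rho> n - 1\<bar> * norm \<Lambda>"
            by (simp add: dist_norm)
          also have "\<dots> \<le> \<bar>\<rho> n - 1\<bar> * (norm x + R)"
            by (intro mult_left_mono \<open>norm \<Lambda> \<le> norm x + R\<close>) simp
          finally show "dist (matrix_map c (\<rho> n *\<^sub>R \<Lambda>)) (matrix_map c \<Lambda>) < e"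
            using elim C[of 1 \<Lambda>] C[of "\<rho> n" \<Lambda>] \<rho>[of n] \<Lambda> by (intro d(2)) simp_all
        qed
      qed
    qed
    then show "\<exists>R>0. cball x R \<subseteq> interior D \<and>
        uniform_limit (cball x R) (\<lambda>n \<Lambda>. matrix_map c (\<rho> n *\<^sub>R \<Lambda>)) (matrix_map c) sequentially"
      using R by blast
  qed
qed

lemma sv_holomorphic_on_cong:
  assumes "open S" "\<And>x. x \<in> S \<Longrightarrow> f x = g x" "sv_holomorphic_on f S"
  shows "sv_holomorphic_on g S"
  unfolding sv_holomorphic_on_def
proof
  fix x
  assume x: "x \<in> S"
  then obtain D where "(f has_derivative D) (at x)" "\<forall>c v. D (c *\<^sub>C v) = c *\<^sub>C D v"
    using assms(3) unfolding sv_holomorphic_on_def by blast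
  moreover from this(1) have "(g has_derivative D) (at x)"
    by (rule has_derivative_transform_within_open[OF _ assms(1) x assms(2)])
  ultimately show "\<exists>D. (g has_derivative D) (at x) \<and> (\<forall>c v. D (c *\<^sub>C v) = c *\<^sub>C D v)"
    by blast
qed

section \<open>Transfer to the matrix domain and conclusion\<close>

context frame
begin

lemma starlike_matrix_domain:
  assumes "starlike_at_0 (nc_domain a m (id_blinfun :: 'h \<Rightarrow>\<^sub>L 'h))"
  shows "starlike_at_0 (matrix_domain a m :: (complex ^ 'p ^ 'p ^ 'n::finite) set)"
  unfolding starlike_at_0_def
proof (intro ballI)
  fix \<Lambda> :: "complex ^ 'p ^ 'p ^ 'n" and r :: real
  assume "\<Lambda> \<in> matrix_domain a m" "r \<in> {0..<1}"
  then have "r *\<^sub>R embed \<Lambda> \<in> nc_domain a m id_blinfun"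
    using assms by (simp add: starlike_at_0_def embed_mem_iff)
  then have "embed (r *\<^sub>R \<Lambda>) \<in> nc_domain a m id_blinfun"
    by (simp only: linear_scale[OF bounded_linear.linear[OF bounded_linear_embed]])
  then show "r *\<^sub>R \<Lambda> \<in> matrix_domain a m"
    by (simp only: embed_mem_iff)
qed

text \<open>\<open>matrix_map\<close> is a radial limit by definition. At a point already contracted
  by \<open>r < 1\<close>, continuity of \<open>F\<close> identifies that limit with the sum of the
  series.\<close>

lemma matrix_part_sums:
  fixes \<Lambda> :: "complex ^ 'p ^ 'p ^ 'n::finite"
  assumes cont: "continuous_on (nc_domain a m (id_blinfun :: 'h \<Rightarrow>\<^sub>L 'h)) F"
    and star: "starlike_at_0 (nc_domain a m (id_blinfun :: 'h \<Rightarrow>\<^sub>L 'h))"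
    and rep: "free_holomorphic_rep K a m c F"
    and \<Lambda>: "\<Lambda> \<in> matrix_domain a m" and r: "r \<in> {0..<1}"
  shows "matrix_part (c j) \<Lambda> r sums (matrix_map c (r *\<^sub>R \<Lambda>) $ j)"
proof -
  have "r *\<^sub>R \<Lambda> \<in> matrix_domain a m"
    using starlike_matrix_domain[OF star] \<Lambda> r by (simp add: starlike_at_0_def)
  then have "matrix_map c (r *\<^sub>R \<Lambda>) $ j = compression (F (embed (r *\<^sub>R \<Lambda>)) $ j)"
    by (intro matrix_map_limit(4)[OF _ cont star rep coinvariant_embed]) (simp add: embed_mem_iff)
  moreover have "embed (r *\<^sub>R \<Lambda>) = r *\<^sub>R embed \<Lambda>"
    by (rule linear_scale[OF bounded_linear.linear[OF bounded_linear_embed]])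
  ultimately show ?thesis
    using matrix_map_limit(1)[OF embed_mem_iff[THEN iffD2, OF \<Lambda>] cont star rep coinvariant_embed r, of j]
    by simp
qed

lemma matrix_map_definedI:
  assumes cont: "continuous_on (nc_domain a m (id_blinfun :: 'h \<Rightarrow>\<^sub>L 'h)) F"
    and star: "starlike_at_0 (nc_domain a m (id_blinfun :: 'h \<Rightarrow>\<^sub>L 'h))"
    and rep: "free_holomorphic_rep K a m c F"
  shows "matrix_map_defined c (matrix_domain a m :: (complex ^ 'p ^ 'p ^ 'n::finite) set)"
  unfolding matrix_map_defined_def
  using sums_summable[OF matrix_part_sums[OF cont star rep]]
    matrix_map_limit(3)[OF embed_mem_iff[THEN iffD2] cont star rep coinvariant_embed]
  by blast

end

text \<open>With equal dimensions, invariance of domain makes the image of each interior open, hence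
  contained in the other interior; doing this for both maps gives equality.\<close>

lemma biholomorphic_onto_interior:
  fixes f :: "'a::{complex_hilbert, euclidean_space} \<Rightarrow> 'b::{complex_hilbert, euclidean_space}"
  assumes hom: "homeomorphism S T f g" and dim: "DIM('a) = DIM('b)"
    and f: "sv_holomorphic_on f (interior S)" and g: "sv_holomorphic_on g (interior T)"
  shows "biholomorphic_onto f (interior S) (interior T)"
proof -
  have f': "f ` interior S \<subseteq> interior T"
  proof (rule interior_maximal)
    show "f ` interior S \<subseteq> T"
      using hom interior_subset[of S] by (auto simp: homeomorphism_def)
    have "inj_on f S"
      using hom by (metis homeomorphism_apply1 inj_on_inverseI)
    then show "open (f ` interior S)"
      using hom interior_subset[of S] dim by (intro invariance_of_domain_gen)
        (auto simp: homeomorphism_def intro: continuous_on_subset inj_on_subset)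
  qed
  have g': "g ` interior T \<subseteq> interior S"
  proof (rule interior_maximal)
    show "g ` interior T \<subseteq> S"
      using hom interior_subset[of T] by (auto simp: homeomorphism_def)
    have "inj_on g T"
      using hom by (metis homeomorphism_apply2 inj_on_inverseI)
    then show "open (g ` interior T)"
      using hom interior_subset[of T] dim by (intro invariance_of_domain_gen)
        (auto simp: homeomorphism_def intro: continuous_on_subset inj_on_subset)
  qed
  have gf: "g (f x) = x" if "x \<in> interior S" for x
    using hom that interior_subset by (blast intro: homeomorphism_apply1)
  have fg: "f (g y) = y" if "y \<in> interior T" for y
    using hom that interior_subset by (blast intro: homeomorphism_apply2)
  have bij: "bij_betw f (interior S) (interior T)"
    by (rule bij_betw_byWitness[where f' = g]) (use f' g' gf fg in auto)
  \<comment> \<open>The inverse taken relative to the interior agrees with \<open>g\<close> on an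
    open set, so the derivatives carry over.\<close>
  have "sv_holomorphic_on (inv_into (interior S) f) (interior T)"
  proof (rule sv_holomorphic_on_cong[OF open_interior _ g])
    fix y
    assume "y \<in> interior T"
    then show "g y = inv_into (interior S) f y"
      using bij g' fg by (intro inv_into_f_eq[symmetric]) (auto simp: bij_betw_def)
  qed
  then show ?thesis
    using bij f by (simp add: biholomorphic_onto_def)
qed

text \<open>\<open>c\<close> ranges over all coefficient families representing \<open>F\<close>.
  Since \<open>Lim\<close> and the infinite sum are total, the clause
  \<open>matrix_map_defined\<close> records that the sums and radial limits exist.\<close>

theorem theorem4p3:
  fixes f :: "'n::finite list \<Rightarrow> real"
    and g :: "'q::finite list \<Rightarrow> real"
    and m l :: nat
    and F :: "('h::complex_hilbert \<Rightarrow>\<^sub>L 'h) ^ 'n \<Rightarrow> ('h \<Rightarrow>\<^sub>L 'h) ^ 'q"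
    and c :: "'q \<Rightarrow> 'n list \<Rightarrow> complex"
  assumes "separable_space (euclidean :: 'h topology)"
    and "infinite_dimensional TYPE('h)"
    and "positive_regular f" and "positive_regular g"
    and "m \<ge> 1" and "l \<ge> 1"
    and "closed (nc_domain f m (id_blinfun :: 'h \<Rightarrow>\<^sub>L 'h))"
    and "starlike_at_0 (nc_domain f m (id_blinfun :: 'h \<Rightarrow>\<^sub>L 'h))"
    and "closed (nc_domain g l (id_blinfun :: 'h \<Rightarrow>\<^sub>L 'h))"
    and "starlike_at_0 (nc_domain g l (id_blinfun :: 'h \<Rightarrow>\<^sub>L 'h))"
    and "free_biholomorphic TYPE('k::complex_hilbert) f m g l F"
    and "free_holomorphic_rep TYPE('k) f m c F"
  shows "CARD('n) = CARD('q) \<and>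
    matrix_map_defined c (matrix_domain f m :: (complex ^ 'p::finite ^ 'p ^ 'n) set) \<and>
    (\<exists>G. homeomorphism (matrix_domain f m :: (complex ^ 'p ^ 'p ^ 'n) set)
           (matrix_domain g l :: (complex ^ 'p ^ 'p ^ 'q) set) (matrix_map c) G) \<and>
    biholomorphic_onto (matrix_map c)
      (interior (matrix_domain f m :: (complex ^ 'p ^ 'p ^ 'n) set))
      (interior (matrix_domain g l :: (complex ^ 'p ^ 'p ^ 'q) set))"
proof -
  let ?Df = "matrix_domain f m :: (complex ^ 'p ^ 'p ^ 'n) set"
  let ?Dg = "matrix_domain g l :: (complex ^ 'p ^ 'p ^ 'q) set"
  note starF = assms(8) and starG = assms(10) and repF = assms(12)
  obtain V :: "(complex ^ 'p) \<Rightarrow>\<^sub>L 'h" and V' where "isometry V V'"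
    using isometry_exists[OF assms(2)] by blast
  then interpret frame V V'
    by (rule frame.intro)
  obtain G d where hom: "homeomorphism (nc_domain f m id_blinfun) (nc_domain g l id_blinfun) F G"
    and repG: "free_holomorphic_rep TYPE('k) g l d G"
    using assms(11) unfolding free_biholomorphic_def by blast
  have contF: "continuous_on (nc_domain f m id_blinfun) F"
    and contG: "continuous_on (nc_domain g l id_blinfun) G"
    using hom by (auto simp: homeomorphism_def)
  have hom': "homeomorphism ?Df ?Dg (matrix_map c) (matrix_map d)"
    by (rule matrix_map_homeomorphism[OF hom starF starG repF repG])
  have contc: "continuous_on ?Df (matrix_map c)" and contd: "continuous_on ?Dg (matrix_map d)"
    and injc: "inj_on (matrix_map c) ?Df" and injd: "inj_on (matrix_map d) ?Dg"
    using hom' by (auto simp: homeomorphism_def intro: inj_on_inverseI)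
  \<comment> \<open>Invariance of dimension needs a nonempty open set; the point 0 of the interior
    provides it.\<close>
  have "DIM(complex ^ 'p ^ 'p ^ 'n) \<le> DIM(complex ^ 'p ^ 'p ^ 'q)"
    using zero_in_interior_matrix_domain[OF assms(3)] interior_subset
    by (intro invariance_of_dimension[of "interior ?Df" "matrix_map c"] open_interior
        continuous_on_subset[OF contc] inj_on_subset[OF injc]) auto
  moreover have "DIM(complex ^ 'p ^ 'p ^ 'q) \<le> DIM(complex ^ 'p ^ 'p ^ 'n)"
    using zero_in_interior_matrix_domain[OF assms(4)] interior_subset
    by (intro invariance_of_dimension[of "interior ?Dg" "matrix_map d"] open_interior
        continuous_on_subset[OF contd] inj_on_subset[OF injd]) auto
  ultimately have dim: "DIM(complex ^ 'p ^ 'p ^ 'n) = DIM(complex ^ 'p ^ 'p ^ 'q)"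
    by (rule antisym)
  \<comment> \<open>The real dimensions are \<open>2 * CARD('p)\<^sup>2\<close> times the numbers of
    indeterminates, and the positive common factor cancels.\<close>
  then have "CARD('n) = CARD('q)"
    by simp
  moreover have "matrix_map_defined c ?Df"
    by (rule matrix_map_definedI[OF contF starF repF])
  moreover have "biholomorphic_onto (matrix_map c) (interior ?Df) (interior ?Dg)"
    by (intro biholomorphic_onto_interior[OF hom' dim] sv_holomorphic_on_matrix_map
        starlike_matrix_domain matrix_part_sums[OF contF starF repF] matrix_part_sums[OF contG starG repG]
        starF starG contc contd)
  ultimately show ?thesis
    using hom' by blast
qed

end
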